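(* Let $\Omega$ be a holomorphic one-form in a neighborhood $U$ of the closed ball $B^{4m}[1]=\{z\in\mathbb{C}^{2m}:\|z\|\le1\}$ such that (1) $\Omega\cdot\vec R=0$, where $\vec R=\sum_{j=1}^{2m}z_j\,\partial/\partial z_j$ is the radial vector field on $\mathbb{C}^{2m}$, and (2) $\Omega$ has no zeros on $S^{4m-1}(1)=\partial B^{4m}[1]$. Then $\operatorname{Ker}(\Omega)$ is homotopic to the linear distribution $\operatorname{Ker}(\Omega_{\mathbb{J}(2m)})$, where $\Omega_{\mathbb{J}(2m)}=\sum_{j=1}^m(z_{2j-1}dz_{2j}-z_{2j}dz_{2j-1})$, by distributions $\operatorname{Ker}(\Omega_s)$, $0\le s\le 1$, with $\Omega_0=\Omega$ and $\Omega_1=\Omega_{\mathbb{J}(2m)}$, where each $\Omega_s$ is a holomorphic one-form satisfying (1) and (2).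
   Context: Two codimension one holomorphic distributions $\Delta_1,\Delta_2$ on a complex manifold $M$ are homotopic if there is a $C^\infty$ family $\{P_s\}_{s\in[0,1]}$ of holomorphic distributions on $M$ with $P_0=\Delta_1$ and $P_1=\Delta_2$. For a holomorphic one-form $\Omega$, $\operatorname{Ker}(\Omega)$ is the distribution of kernels of $\Omega$. *)

theory Defs
  imports "HOL-Analysis.Analysis"
begin

text \<open>Points of C^(2m) are modelled as vectors indexed by 'm \<times> 2: the coordinate
  z_(2j-1) is z $ (j,1) and z_(2j) is z $ (j,2); m = CARD('m).
  A holomorphic one-form Omega = sum_i a_i(z) dz_i is represented by its coefficient
  map A with A z $ i = a_i(z).\<close>

definition oneform_apply :: "(complex^'n::finite \<Rightarrow> complex^'n) \<Rightarrow> complex^'n \<Rightarrow> complex^'n \<Rightarrow> complex"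
  where "oneform_apply A z v = (\<Sum>i\<in>UNIV. A z $ i * v $ i)"

definition holo_on :: "(complex^'n::finite \<Rightarrow> complex^'k::finite) \<Rightarrow> (complex^'n) set \<Rightarrow> bool"
  where "holo_on f S \<longleftrightarrow> (\<forall>z\<in>S. \<exists>L. (f has_derivative L) (at z) \<and>
                                   (\<forall>c v. L (c *s v) = c *s L v))"

definition radial_contr :: "(complex^'n::finite \<Rightarrow> complex^'n) \<Rightarrow> complex^'n \<Rightarrow> complex"
  where "radial_contr A z = oneform_apply A z z"

definition form_ker :: "(complex^'n::finite \<Rightarrow> complex^'n) \<Rightarrow> complex^'n \<Rightarrow> (complex^'n) set"
  where "form_ker A z = {v. oneform_apply A z v = 0}"

text \<open>Coefficients of Omega_J(2m) = sum_j (z_(2j-1) dz_(2j) - z_(2j) dz_(2j-1)).\<close>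
definition OmegaJ :: "complex^('m::finite \<times> 2) \<Rightarrow> complex^('m \<times> 2)"
  where "OmegaJ z = (\<chi> p. if snd p = 1 then - z $ (fst p, 2) else z $ (fst p, 1))"

text \<open>C^infinity on a set S (real sense): all iterated (directional) Frechet derivatives
  exist (relative to S) and are continuous on S.  D k x [h1,...,hk] is the k-th derivative
  at x applied to h1,...,hk.\<close>
definition smooth_on :: "'a::real_normed_vector set \<Rightarrow> ('a \<Rightarrow> 'b::real_normed_vector) \<Rightarrow> bool"
  where "smooth_on S f \<longleftrightarrow> (\<exists>D :: nat \<Rightarrow> 'a \<Rightarrow> 'a list \<Rightarrow> 'b.
     (\<forall>x\<in>S. D 0 x [] = f x) \<and>
     (\<forall>k vs. length vs = k \<longrightarrow> continuous_on S (\<lambda>x. D k x vs)) \<and>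
     (\<forall>k vs x. x \<in> S \<longrightarrow> length vs = k \<longrightarrow>
        ((\<lambda>y. D k y vs) has_derivative (\<lambda>h. D (Suc k) x (h # vs))) (at x within S)))"

end

theory Submission
  imports Defs "HOL-Complex_Analysis.Cauchy_Integral_Formula"
begin

text \<open>The coefficient map A of the form satisfies A(z) . z = 0, so conj A is orthogonal to the
  identity and, near the sphere, homotopic to it through maps without zeros. In even complex dimension
  conjugation preserves orientation, hence the holomorphic map A has degree one on the ball, and so
  does every small holomorphic perturbation F. A nondegenerate zero of F counts with
  multiplicity at least one, so F has at most one. If A had a second zero, or a degenerate zero at
  the origin, a small perturbation would have two nondegenerate zeros. Consequently
  \<bar>A z\<bar> \<ge> \<epsilon> \<bar>z\<bar> on the ball and the linear part B of A at 0 is invertible.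
  Now A(\<tau> z) / \<tau> joins A to B, and B is joined to J by a path (1 - \<zeta>) B + \<zeta> J
  where \<zeta> runs from 0 to 1 in the complex plane and avoids the finitely many roots of the
  determinant. Moving both parameters simultaneously, with \<tau> decaying long before \<zeta> leaves
  a neighbourhood of 0, gives a smooth family. Degree one is established by the Milnor-Rogers trick: the integral of
  det (t I + DP) over the ball is polynomial in t, and for large t it is the volume of the image.\<close>

section \<open>Degree of a map that is the identity outside the ball\<close>

text \<open>Degree enters only through a comparison of volumes. Composed with a coordinatewise
  sigmoid whose Jacobian lives on a small cube, a map equal to the identity outside the ball has a
  fixed Jacobian integral v > 0, while each nondegenerate zero alone already accounts for v once the
  Jacobian is nonnegative over that cube. The inequality |A z| >= \<epsilon> |z| is the target
  because it serves twice: it excludes both further zeros and a degenerate zero at the origin, and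
  it bounds |A(\<tau> z)| / \<tau> from below on the sphere uniformly in \<tau>. The straight
  segment from A to J may pass through zeros (take A = -J). Close to the linear part B only
  determinants matter, and their roots can be bypassed in the complex plane. Running the rescaling
  and the linear path one after the other could break smoothness at the junction, so both depend
  polynomially on a single time. Joint smoothness in (s, z), endpoints of [0,1] included, is then
  inherited from a map that is holomorphic in one more complex variable.\<close>

lemma IVT_pos:
  fixes f :: "real \<Rightarrow> real"
  assumes "continuous_on {0..1} f" "\<And>t. t \<in> {0..1} \<Longrightarrow> f t \<noteq> 0" "f 0 > 0"
  shows "f 1 > 0"
proof (rule ccontr)
  assume "\<not> f 1 > 0"
  then obtain t where "0 \<le> t" "t \<le> 1" "f t = 0"
    using IVT2'[of f 1 0 0] assms by force
  then show False
    using assms(2) by auto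
qed

lemma continuous_on_det:
  fixes M :: "'a::topological_space \<Rightarrow> real^'n^'n"
  assumes "\<And>i j. continuous_on S (\<lambda>x. M x $ i $ j)"
  shows "continuous_on S (\<lambda>x. det (M x))"
  unfolding det_def by (intro continuous_intros assms)

lemma det_linear_nonzero_iff:
  fixes L :: "real^'n \<Rightarrow> real^'n"
  assumes "linear L"
  shows "det (matrix L) \<noteq> 0 \<longleftrightarrow> (\<forall>x. L x = 0 \<longrightarrow> x = 0)"
  using assms det_nz_iff_inj[of L] linear_injective_0[of L] by blast

text \<open>The second difference of the C^1 function (max 0 t)^2 is a C^1 sigmoid that is constant
  outside [-1,1].\<close>
definition sig :: "real \<Rightarrow> real"
  where "sig t = (max 0 (t + 1))\<^sup>2 - 2 * (max 0 t)\<^sup>2 + (max 0 (t - 1))\<^sup>2"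

definition dsig :: "real \<Rightarrow> real"
  where "dsig t = 2 * max 0 (1 - \<bar>t\<bar>)"

text \<open>One quadratic bound on the remainder covers all sign patterns of x and t, so the kink of
  \<open>max 0 t\<close> at 0 needs no one-sided derivatives.\<close>

lemma DERIV_max_sq: "((\<lambda>t::real. (max 0 t)\<^sup>2) has_real_derivative 2 * max 0 t) (at t)"
proof -
  have rem: "\<bar>(max 0 x)\<^sup>2 - (max 0 t)\<^sup>2 - 2 * max 0 t * (x - t)\<bar> \<le> (x - t)\<^sup>2" for x :: real
  proof -
    consider "0 \<le> x" "0 \<le> t" | "x \<le> 0" "t \<le> 0" | "0 \<le> x" "t \<le> 0" | "x \<le> 0" "0 \<le> t"
      by linarith
    then show ?thesis
    proof cases
      case 1
      then have "(max 0 x)\<^sup>2 - (max 0 t)\<^sup>2 - 2 * max 0 t * (x - t) = (x - t)\<^sup>2"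
        by (simp add: power2_eq_square algebra_simps)
      then show ?thesis by simp
    next
      case 3
      then have "x\<^sup>2 \<le> (x - t)\<^sup>2" by (intro power_mono) auto
      with 3 show ?thesis by (simp add: max_absorb1)
    next
      case 4
      have e: "(max 0 x)\<^sup>2 - (max 0 t)\<^sup>2 - 2 * max 0 t * (x - t) = (x - t)\<^sup>2 - x\<^sup>2"
        using 4 by (simp add: power2_eq_square algebra_simps max_absorb1)
      have "x\<^sup>2 \<le> (x - t)\<^sup>2"
        using 4 power_mono[of "-x" "t - x" 2] by (simp add: power2_commute)
      then show ?thesis unfolding e by simp
    qed (simp add: max_absorb1)
  qed
  show ?thesis
    unfolding has_field_derivative_def has_derivative_at2
  proof (intro conjI)
    show "bounded_linear ((*) (2 * max 0 t))" by (rule bounded_linear_mult_right)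
    have lim: "((\<lambda>y. \<bar>y - t\<bar>) \<longlongrightarrow> 0) (at t)"
      by (auto intro!: tendsto_eq_intros)
    show "((\<lambda>y. (1 / norm (y - t)) *\<^sub>R ((max 0 y)\<^sup>2 - ((max 0 t)\<^sup>2 + 2 * max 0 t * (y - t)))) \<longlongrightarrow> 0) (at t)"
    proof (rule Lim_null_comparison[OF _ lim])
      show "\<forall>\<^sub>F y in at t. norm ((1 / norm (y - t)) *\<^sub>R ((max 0 y)\<^sup>2 - ((max 0 t)\<^sup>2 + 2 * max 0 t * (y - t)))) \<le> \<bar>y - t\<bar>"
      proof (rule eventually_at_filter[THEN iffD2, OF always_eventually], intro allI impI)
        fix y assume "y \<noteq> t"
        have "\<bar>(max 0 y)\<^sup>2 - ((max 0 t)\<^sup>2 + 2 * max 0 t * (y - t))\<bar> \<le> \<bar>y - t\<bar> * \<bar>y - t\<bar>"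
          using rem[of y] by (simp add: power2_eq_square algebra_simps)
        then show "norm ((1 / norm (y - t)) *\<^sub>R ((max 0 y)\<^sup>2 - ((max 0 t)\<^sup>2 + 2 * max 0 t * (y - t)))) \<le> \<bar>y - t\<bar>"
          using \<open>y \<noteq> t\<close> by (simp add: abs_mult divide_le_eq)
      qed
    qed
  qed
qed

lemma DERIV_sig: "(sig has_real_derivative dsig t) (at t)"
proof -
  have 1: "((\<lambda>t::real. (max 0 (t + c))\<^sup>2) has_real_derivative 2 * max 0 (t + c)) (at t)" for c
    by (rule DERIV_chain2[OF DERIV_max_sq, of "\<lambda>t. t + c" 1, simplified])
      (auto intro!: derivative_eq_intros)
  have 2: "dsig t = 2 * max 0 (t + 1) - 2 * (2 * max 0 (t + 0)) + 2 * max 0 (t + - 1)"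
    by (auto simp: dsig_def max_def)
  have 3: "sig = (\<lambda>t. (max 0 (t + 1))\<^sup>2 - 2 * (max 0 (t + 0))\<^sup>2 + (max 0 (t + - 1))\<^sup>2)"
    by (auto simp: sig_def)
  show ?thesis
    unfolding 2 3 by (intro DERIV_add DERIV_diff DERIV_cmult 1)
qed

lemma sig_le: "t \<le> -1 \<Longrightarrow> sig t = 0" and sig_ge: "t \<ge> 1 \<Longrightarrow> sig t = 2"
  by (auto simp: sig_def max_def power2_eq_square algebra_simps)

lemma dsig_bounds: "0 \<le> dsig t" "dsig t \<le> 2" and dsig_pos: "\<bar>t\<bar> < 1 \<Longrightarrow> dsig t > 0"
  and dsig_zero: "\<bar>t\<bar> \<ge> 1 \<Longrightarrow> dsig t = 0"
  by (auto simp: dsig_def)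

lemma continuous_on_dsig [continuous_intros]:
  "continuous_on S f \<Longrightarrow> continuous_on S (\<lambda>x. dsig (f x))"
  unfolding dsig_def by (intro continuous_intros)

lemma sig_inj:
  assumes "\<bar>s\<bar> < 1" "\<bar>t\<bar> < 1" "sig s = sig t" shows "s = t"
proof -
  have "sig a < sig b" if "-1 < a" "a < b" "b < 1" for a b
    by (rule DERIV_pos_imp_increasing[OF that(2)]) (use that DERIV_sig dsig_pos in force)
  from this[of s t] this[of t s] show ?thesis using assms by linarith
qed

lemma sig_range: "0 \<le> sig t" "sig t \<le> 2"
proof -
  have mono: "sig a \<le> sig b" if "a \<le> b" for a b
    by (rule DERIV_nonneg_imp_nondecreasing[OF that]) (use DERIV_sig dsig_bounds in blast)
  show "0 \<le> sig t" "sig t \<le> 2"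
    using mono[of "min (-1) t" t] mono[of t "max 1 t"] sig_le[of "min (-1) t"] sig_ge[of "max 1 t"] by auto
qed

text \<open>Bijectivity makes the image of the ball depend only on the values of P outside the ball.\<close>
lemma bij_dilation_plus_Lipschitz:
  fixes P :: "'a::euclidean_space \<Rightarrow> 'a"
  assumes L: "\<And>x y. norm (P x - P y) \<le> L * norm (x - y)" and t: "t > L" "t > 0"
  shows "bij (\<lambda>x. t *\<^sub>R x + P x)"
proof (rule bijI)
  show "inj (\<lambda>x. t *\<^sub>R x + P x)"
  proof (rule injI)
    fix x y assume "t *\<^sub>R x + P x = t *\<^sub>R y + P y"
    then have "P y - P x = t *\<^sub>R (x - y)" by (simp add: algebra_simps)
    then have "t * norm (x - y) \<le> L * norm (x - y)"
      using L[of y x] t by (simp add: norm_minus_commute)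
    then show "x = y" using t by (simp add: mult_le_cancel_right)
  qed
  show "surj (\<lambda>x. t *\<^sub>R x + P x)"
    unfolding surj_def
  proof
    fix y
    \<comment> \<open>Solving t x + P x = y means finding a fixed point of this map, a contraction
      because t exceeds the Lipschitz constant of P.\<close>
    let ?g = "\<lambda>x. (1/t) *\<^sub>R (y - P x)"
    have "\<exists>!x. ?g x = x"
    proof (rule banach_fix_type[where c = "max 0 L / t"])
      show "0 \<le> max 0 L / t" "max 0 L / t < 1" using t by auto
      show "\<forall>u v. dist (?g u) (?g v) \<le> max 0 L / t * dist u v"
      proof (intro allI)
        fix u v
        have "norm (P v - P u) \<le> max 0 L * norm (u - v)"
          using L[of v u] mult_right_mono[of L "max 0 L" "norm (u-v)"]
          by (simp add: norm_minus_commute)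
        then have "norm (P v - P u) / t \<le> max 0 L * norm (u - v) / t"
          using t by (simp add: divide_right_mono)
        moreover have "?g u - ?g v = (1/t) *\<^sub>R (P v - P u)"
          by (simp add: algebra_simps)
        ultimately show "dist (?g u) (?g v) \<le> max 0 L / t * dist u v"
          using t by (simp add: dist_norm)
      qed
    qed
    then obtain x where "?g x = x" by auto
    then have "t *\<^sub>R x + P x = y"
      using t by (metis add.commute diff_add_cancel divide_self_if less_irrefl scaleR_one
          scaleR_scaleR times_divide_eq_right mult.right_neutral)
    then show "\<exists>x. y = t *\<^sub>R x + P x" by metis
  qed
qed

text \<open>Along t I + s M with s in [0,1] a kernel vector h satisfies t |h| = s |M h| <= L |h|,
  hence is 0. The determinant keeps the sign it has at s = 0, where it is a power of t.\<close>

lemma det_dilation_plus_pos: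
  fixes M :: "real^'n \<Rightarrow> real^'n"
  assumes lin: "linear M" and L: "\<And>h. norm (M h) \<le> L * norm h" and t: "t > L" "t > 0"
  shows "det (matrix (\<lambda>h. t *\<^sub>R h + M h)) > 0"
proof -
  define f where "f = (\<lambda>s. det (matrix (\<lambda>h. t *\<^sub>R h + s *\<^sub>R M h)))"
  have "f 1 > 0"
  proof (rule IVT_pos)
    show "continuous_on {0..1} f"
      unfolding f_def by (intro continuous_on_det) (auto simp: matrix_def intro!: continuous_intros)
    have "(\<lambda>h::real^'n. t *\<^sub>R h + 0 *\<^sub>R M h) = (\<lambda>h. t *\<^sub>R h)" by auto
    then show "f 0 > 0"
      unfolding f_def
      by (subst det_diagonal) (auto simp: matrix_def axis_def t intro!: prod_pos)
    fix s :: real assume s: "s \<in> {0..1}"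
    have "linear (\<lambda>h. t *\<^sub>R h + s *\<^sub>R M h)"
      using lin by (intro linear_compose_add linear_compose_scale_right linear_id[unfolded id_def])
    then show "f s \<noteq> 0"
      unfolding f_def
    proof (subst det_linear_nonzero_iff, assumption, intro allI impI)
      fix h assume "t *\<^sub>R h + s *\<^sub>R M h = 0"
      then have "t *\<^sub>R h = - (s *\<^sub>R M h)" by (simp add: eq_neg_iff_add_eq_0)
      then have "t * norm h = s * norm (M h)" using t s by (metis abs_of_nonneg atLeastAtMost_iff norm_minus_cancel norm_scaleR less_imp_le)
      also have "\<dots> \<le> 1 * norm (M h)" using s by (intro mult_right_mono) auto
      also have "\<dots> \<le> L * norm h" using L by simp
      finally show "h = 0" using t by (simp add: mult_le_cancel_right)
    qed
  qed
  then show ?thesis by (simp add: f_def)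
qed

section \<open>Jacobian integrals as polynomials in the dilation parameter\<close>

lemma poly_det: "poly (det X) t = det (\<chi> i j. poly (X $ i $ j) t)"
  for X :: "'a::comm_ring_1 poly^'n^'n"
  unfolding det_def by (simp add: poly_sum poly_prod)

lemma continuous_on_coeff_prod:
  fixes p :: "'i \<Rightarrow> 'a::topological_space \<Rightarrow> real poly"
  assumes "finite I" "\<And>i k. i \<in> I \<Longrightarrow> continuous_on S (\<lambda>x. coeff (p i x) k)"
  shows "continuous_on S (\<lambda>x. coeff (\<Prod>i\<in>I. p i x) k)"
  using assms
proof (induction I arbitrary: k rule: finite_induct)
  case (insert i I)
  then show ?case
    by (simp add: coeff_mult) (intro continuous_intros, auto)
qed simp

lemma continuous_on_coeff_det:
  fixes X :: "'a::topological_space \<Rightarrow> real poly^'n^'n"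
  assumes "\<And>i j k. continuous_on S (\<lambda>x. coeff (X x $ i $ j) k)"
  shows "continuous_on S (\<lambda>x. coeff (det (X x)) k)"
  unfolding det_def coeff_sum coeff_mult
  by (intro continuous_intros continuous_on_coeff_prod assms) auto

lemma degree_det_linear:
  fixes X :: "real poly^'n^'n"
  assumes "\<And>i j. degree (X $ i $ j) \<le> 1"
  shows "degree (det X) \<le> CARD('n)"
  unfolding det_def
proof (rule degree_sum_le)
  fix p :: "'n \<Rightarrow> 'n"
  have "degree (\<Prod>i\<in>UNIV. X $ i $ p i) \<le> (\<Sum>i\<in>UNIV. degree (X $ i $ p i))"
    using degree_prod_sum_le[of UNIV "\<lambda>i. X $ i $ p i"] by (simp add: o_def)
  also have "\<dots> \<le> (\<Sum>i\<in>(UNIV::'n set). 1)" by (intro sum_mono assms)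
  finally have "degree (\<Prod>i\<in>UNIV. X $ i $ p i) \<le> CARD('n)" by simp
  then show "degree (of_int (sign p) * (\<Prod>i\<in>UNIV. X $ i $ p i)) \<le> CARD('n)"
    using degree_mult_le[of "of_int (sign p)" "\<Prod>i\<in>UNIV. X $ i $ p i"] by simp
qed (simp add: finite_permutations)

lemma absolutely_integrable_on_bounded:
  fixes f :: "'a::euclidean_space \<Rightarrow> real"
  assumes "continuous_on UNIV f" "bounded S" "S \<in> sets lebesgue"
  shows "f absolutely_integrable_on S"
proof -
  obtain a where a: "S \<subseteq> cbox (-a) a"
    using bounded_subset_cbox_symmetric[OF assms(2)] by blast
  have "f absolutely_integrable_on cbox (-a) a"
    using assms(1) continuous_on_subset by (intro absolutely_integrable_continuous) blast
  then show ?thesis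
    using a assms(3) set_integrable_subset by blast
qed

text \<open>The determinant is expanded in powers of t with coefficients continuous in x. The degree
  bound is uniform in x, so the integral can be taken coefficient by coefficient.\<close>

lemma integral_det_pencil_poly:
  fixes M :: "'a::euclidean_space \<Rightarrow> real^'n^'n"
  assumes S: "bounded S" "S \<in> sets lebesgue"
    and cont: "\<And>i j. continuous_on UNIV (\<lambda>x. M x $ i $ j)"
  obtains q where "\<And>t. integral S (\<lambda>x. det (t *\<^sub>R mat 1 + M x)) = poly q t"
proof -
  define X where "X = (\<lambda>x. \<chi> i j. [:M x $ i $ j, mat 1 $ i $ j:])"
  define c where "c = (\<lambda>k x. coeff (det (X x)) k)"
  have "continuous_on UNIV (\<lambda>x. coeff (X x $ i $ j) k)" for i j k
    by (cases k) (auto simp: X_def coeff_pCons intro: cont)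
  then have "continuous_on UNIV (c k)" for k
    unfolding c_def by (intro continuous_on_coeff_det)
  then have int: "c k integrable_on S" for k
    using absolutely_integrable_on_bounded S set_lebesgue_integral_eq_integral(1) by blast
  have eq: "det (t *\<^sub>R mat 1 + M x) = (\<Sum>k\<le>CARD('n). c k x * t ^ k)" for t x
  proof -
    have "degree (det (X x)) \<le> CARD('n)"
      by (rule degree_det_linear) (simp add: X_def)
    then have "poly (det (X x)) t = (\<Sum>k\<le>CARD('n). c k x * t ^ k)"
      unfolding c_def
      by (subst (1) poly_as_sum_of_monoms'[symmetric, of _ "CARD('n)"]) (simp_all add: poly_sum poly_monom)
    moreover have "(\<chi> i j. poly (X x $ i $ j) t) = t *\<^sub>R mat 1 + M x"
      by (simp add: X_def vec_eq_iff)
    ultimately show ?thesis by (simp add: poly_det)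
  qed
  show ?thesis
  proof
    fix t
    have "integral S (\<lambda>x. det (t *\<^sub>R mat 1 + M x)) = (\<Sum>k\<le>CARD('n). integral S (c k) * t ^ k)"
      unfolding eq by (subst integral_sum) (auto intro: integrable_on_mult_left int)
    also have "\<dots> = poly (\<Sum>k\<le>CARD('n). monom (integral S (c k)) k) t"
      by (simp add: poly_sum poly_monom)
    finally show "integral S (\<lambda>x. det (t *\<^sub>R mat 1 + M x)) = poly (\<Sum>k\<le>CARD('n). monom (integral S (c k)) k) t" .
  qed
qed

lemma matrix_dilation_plus:
  "linear f \<Longrightarrow> matrix (\<lambda>h. t *\<^sub>R h + f h) = t *\<^sub>R mat 1 + matrix f" for f :: "real^'n \<Rightarrow> real^'n"
  by (simp add: matrix_def vec_eq_iff mat_def axis_def)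

text \<open>For t > L the map is bijective with positive Jacobian, so the absolute value in the
  change of variables formula disappears and the signed integral is a volume. By the mean value
  inequality the derivative bound L is also a Lipschitz constant.\<close>

lemma integral_det_dilation:
  fixes P :: "real^'n::{finite,wellorder} \<Rightarrow> real^'n::_"
  assumes der: "\<And>x. (P has_derivative P' x) (at x)"
    and cont: "\<And>h. continuous_on UNIV (\<lambda>x. P' x h)"
    and bd: "\<And>x h. norm (P' x h) \<le> L * norm h"
    and t: "t > L" "t > 0"
  shows "integral (ball 0 1) (\<lambda>x. det (t *\<^sub>R mat 1 + matrix (P' x)))
       = measure lebesgue ((\<lambda>x. t *\<^sub>R x + P x) ` ball 0 1)"
    and "bij (\<lambda>x. t *\<^sub>R x + P x)"
proof -
  have lin: "linear (P' x)" for x using der has_derivative_linear by blast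
  have L0: "0 \<le> L"
    using order_trans[OF norm_ge_zero bd[of _ "axis undefined 1"]] by simp
  have "norm (P x - P y) \<le> L * norm (x - y)" for x y
    by (rule differentiable_bound[of UNIV P P'])
      (auto intro: has_derivative_at_withinI[OF der] onorm_bound[OF L0 bd])
  then show bij: "bij (\<lambda>x. t *\<^sub>R x + P x)"
    using t by (rule bij_dilation_plus_Lipschitz)
  let ?D = "\<lambda>x h. t *\<^sub>R h + P' x h"
  have D: "matrix (?D x) = t *\<^sub>R mat 1 + matrix (P' x)" for x
    by (rule matrix_dilation_plus[OF lin])
  have pos: "det (matrix (?D x)) > 0" for x
    using lin bd t by (rule det_dilation_plus_pos)
  have "continuous_on UNIV (\<lambda>x. det (matrix (?D x)))"
    by (rule continuous_on_det) (auto simp: matrix_def intro!: continuous_intros cont)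
  then have "(\<lambda>x. \<bar>det (matrix (?D x))\<bar>) integrable_on ball 0 1"
    by (intro set_lebesgue_integral_eq_integral(1) absolutely_integrable_on_bounded continuous_intros) auto
  then have "measure lebesgue ((\<lambda>x. t *\<^sub>R x + P x) ` ball 0 1) = integral (ball 0 1) (\<lambda>x. \<bar>det (matrix (?D x))\<bar>)"
    by (intro measure_differentiable_image_eq)
      (auto intro!: derivative_eq_intros has_derivative_at_withinI[OF der] inj_on_subset[OF bij_is_inj[OF bij]])
  also have "\<dots> = integral (ball 0 1) (\<lambda>x. det (matrix (?D x)))"
    using pos by (simp add: less_imp_le)
  finally show "integral (ball 0 1) (\<lambda>x. det (t *\<^sub>R mat 1 + matrix (P' x)))
       = measure lebesgue ((\<lambda>x. t *\<^sub>R x + P x) ` ball 0 1)"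
    by (simp add: D)
qed

text \<open>The integrals of det (t I + DP) and det (t I + DQ) are polynomials in t that agree for all
  large t, hence at t = 0.\<close>
lemma integral_det_eq_of_agree:
  fixes P Q :: "real^'n::{finite,wellorder} \<Rightarrow> real^'n::_"
  assumes P: "\<And>x. (P has_derivative P' x) (at x)" "\<And>h. continuous_on UNIV (\<lambda>x. P' x h)"
      "\<And>x h. norm (P' x h) \<le> L * norm h"
    and Q: "\<And>x. (Q has_derivative Q' x) (at x)" "\<And>h. continuous_on UNIV (\<lambda>x. Q' x h)"
      "\<And>x h. norm (Q' x h) \<le> M * norm h"
    and agree: "\<And>x. norm x \<ge> 1 \<Longrightarrow> P x = Q x"
  shows "integral (ball 0 1) (\<lambda>x. det (matrix (P' x))) = integral (ball 0 1) (\<lambda>x. det (matrix (Q' x)))"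
proof -
  obtain p where p: "\<And>t. integral (ball 0 1) (\<lambda>x. det (t *\<^sub>R mat 1 + matrix (P' x))) = poly p t"
    by (rule integral_det_pencil_poly[of "ball 0 1" "\<lambda>x. matrix (P' x)"])
      (auto simp: matrix_def intro!: continuous_intros P(2))
  obtain q where q: "\<And>t. integral (ball 0 1) (\<lambda>x. det (t *\<^sub>R mat 1 + matrix (Q' x))) = poly q t"
    by (rule integral_det_pencil_poly[of "ball 0 1" "\<lambda>x. matrix (Q' x)"])
      (auto simp: matrix_def intro!: continuous_intros Q(2))
  define T where "T = max 0 (max L M)"
  have "poly (p - q) t = 0" if "t > T" for t
  proof -
    have t: "t > L" "t > M" "t > 0" using that by (auto simp: T_def)
    let ?p = "\<lambda>x. t *\<^sub>R x + P x" and ?q = "\<lambda>x. t *\<^sub>R x + Q x"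
    have bp: "bij ?p" and bq: "bij ?q"
      using integral_det_dilation(2)[OF P t(1,3)] integral_det_dilation(2)[OF Q t(2,3)] by blast+
    have "?p ` (- ball 0 1) = ?q ` (- ball 0 1)"
      using agree by (intro image_cong) auto
    then have "- (?p ` ball 0 1) = - (?q ` ball 0 1)"
      using bp bq by (simp add: bij_image_Compl_eq)
    then have "?p ` ball 0 1 = ?q ` ball 0 1" by simp
    then show ?thesis
      using integral_det_dilation(1)[OF P t(1,3)] integral_det_dilation(1)[OF Q t(2,3)] p q by simp
  qed
  then have "{T<..} \<subseteq> {t. poly (p - q) t = 0}" by auto
  then have "p - q = 0"
    using poly_roots_finite[of "p - q"] finite_subset infinite_Ioi by blast
  then show ?thesis using p[of 0] q[of 0] by simp
qed

text \<open>Each coordinate is squashed at scale e, so the Jacobian is a product of tents, positive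
  on the open cube of half-width e around 0 and zero off it. After composition with
  \<open>cubify e\<close> the Jacobian integral of a map sees only the points sent into this
  cube.\<close>

definition cubify :: "real \<Rightarrow> real^'n \<Rightarrow> real^'n"
  where "cubify e y = (\<chi> i. sig (y $ i / e))"

definition dcubify :: "real \<Rightarrow> real^'n \<Rightarrow> real^'n \<Rightarrow> real^'n"
  where "dcubify e y h = (\<chi> i. dsig (y $ i / e) / e * h $ i)"

lemma has_derivative_cubify: "(cubify e has_derivative dcubify e y) (at y)" for y :: "real^'n"
  unfolding has_derivative_componentwise_within[of "cubify e"]
proof
  fix b :: "real^'n" assume "b \<in> Basis"
  then obtain i where b: "b = axis i 1" by (auto simp: Basis_vec_def)
  have "((\<lambda>y::real^'n. y $ i / e) has_derivative (\<lambda>h. h $ i / e)) (at y)"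
    by (intro bounded_linear_imp_has_derivative bounded_linear_compose[OF bounded_linear_divide] bounded_linear_vec_nth)
  then have "((\<lambda>y::real^'n. sig (y $ i / e)) has_derivative (\<lambda>h. (h $ i / e) * dsig (y $ i / e))) (at y)"
    by (rule DERIV_compose_FDERIV[OF DERIV_sig])
  then show "((\<lambda>x. cubify e x \<bullet> b) has_derivative (\<lambda>x. dcubify e y x \<bullet> b)) (at y)"
    by (simp add: b cubify_def dcubify_def inner_axis mult.commute)
qed

lemma det_dcubify: "det (matrix (dcubify e y)) = (\<Prod>i\<in>UNIV. dsig (y $ i / e) / e)" for y :: "real^'n"
  by (subst det_diagonal) (auto simp: matrix_def dcubify_def axis_def)

lemma linear_dcubify: "linear (dcubify e y)" for y :: "real^'n"
  using has_derivative_cubify has_derivative_linear by blast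

lemma norm_dcubify_le:
  fixes y h :: "real^'n"
  assumes "e > 0" shows "norm (dcubify e y h) \<le> 2 / e * norm h"
proof -
  have "norm (dcubify e y h) \<le> norm ((2 / e) *\<^sub>R h)"
  proof (rule norm_le_componentwise_cart)
    fix i
    have "dsig (y $ i / e) / e * \<bar>h $ i\<bar> \<le> 2 / e * \<bar>h $ i\<bar>"
      using dsig_bounds assms by (intro mult_right_mono divide_right_mono) auto
    then show "norm (dcubify e y h $ i) \<le> norm (((2 / e) *\<^sub>R h) $ i)"
      using dsig_bounds assms by (simp add: dcubify_def abs_mult)
  qed
  then show ?thesis using assms by simp
qed

text \<open>In finite dimension, continuity of \<open>K' x h\<close> in x for each h is continuity
  in operator norm, which is bounded on a compact set.\<close>

lemma continuous_derivative_bounded: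
  fixes K' :: "'a::euclidean_space \<Rightarrow> 'a \<Rightarrow> 'b::euclidean_space"
  assumes lin: "\<And>x. linear (K' x)" and cont: "\<And>h. continuous_on S (\<lambda>x. K' x h)" and "compact S"
  obtains L where "L \<ge> 0" "\<And>x h. x \<in> S \<Longrightarrow> norm (K' x h) \<le> L * norm h"
proof -
  have bl: "bounded_linear (K' x)" for x using lin linear_linear by blast
  have "continuous_on S (\<lambda>x. Blinfun (K' x))"
    by (rule continuous_on_blinfun_componentwise) (simp add: bounded_linear_Blinfun_apply[OF bl] cont)
  then have "compact ((\<lambda>x. Blinfun (K' x)) ` S)"
    using \<open>compact S\<close> compact_continuous_image by blast
  then obtain L where L: "L > 0" "\<And>x. x \<in> S \<Longrightarrow> norm (Blinfun (K' x)) \<le> L"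
    using compact_imp_bounded bounded_pos by (metis imageI)
  have "norm (K' x h) \<le> L * norm h" if "x \<in> S" for x h
    using norm_blinfun[of "Blinfun (K' x)" h] mult_right_mono[OF L(2)[OF that] norm_ge_zero[of h]]
    by (simp add: bounded_linear_Blinfun_apply[OF bl])
  with L show ?thesis using that by (meson less_imp_le)
qed

text \<open>Adapts the inverse function theorem to derivatives given pointwise and to invertibility
  known only as a trivial kernel: a left inverse of the injective derivative at p supplies the
  required inverse.\<close>

lemma local_homeomorphism:
  fixes K :: "'a::euclidean_space \<Rightarrow> 'a"
  assumes der: "\<And>x. (K has_derivative K' x) (at x)"
    and cont: "\<And>h. continuous_on UNIV (\<lambda>x. K' x h)"
    and inj: "\<And>h. K' p h = 0 \<Longrightarrow> h = 0" and "open W" "p \<in> W"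
  obtains U V g where "open U" "p \<in> U" "U \<subseteq> W" "open V" "K p \<in> V" "homeomorphism U V K g"
proof -
  have bl: "bounded_linear (K' x)" for x using der has_derivative_bounded_linear by blast
  have "inj (K' p)"
    using inj linear_injective_0 bl bounded_linear.linear by blast
  then obtain g where g: "linear g" "g \<circ> K' p = id"
    using linear_injective_left_inverse bl bounded_linear.linear by blast
  then have bg: "bounded_linear g" using linear_linear by blast
  have c: "continuous_on W (\<lambda>x. Blinfun (K' x))"
    by (rule continuous_on_blinfun_componentwise)
      (simp add: bounded_linear_Blinfun_apply[OF bl] continuous_on_subset[OF cont])
  have inv: "Blinfun g o\<^sub>L Blinfun (K' p) = id_blinfun"
    using g(2) by (intro blinfun_eqI) (simp add: bounded_linear_Blinfun_apply bl bg fun_eq_iff)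
  have "(K has_derivative blinfun_apply (Blinfun (K' x))) (at x)" for x
    using der by (simp add: bounded_linear_Blinfun_apply[OF bl])
  from inverse_function_theorem[OF \<open>open W\<close> this c \<open>p \<in> W\<close> inv] that show ?thesis
    by metis
qed

text \<open>A C^1 map equal to the identity outside the ball has degree one, so where its Jacobian is
  nonnegative near the preimages of 0 there is room for only one nondegenerate zero.\<close>
lemma no_two_nondegenerate_zeros:
  fixes K :: "real^'n::{finite,wellorder} \<Rightarrow> real^'n::_"
  assumes der: "\<And>x. (K has_derivative K' x) (at x)"
    and cont: "\<And>h. continuous_on UNIV (\<lambda>x. K' x h)"
    and out: "\<And>x. norm x \<ge> 1 \<Longrightarrow> K x = x"
    and c: "c > 0" and nn: "\<And>x. norm (K x) < c \<Longrightarrow> det (matrix (K' x)) \<ge> 0"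
    and z: "K p = 0" "K q = 0" "det (matrix (K' p)) \<noteq> 0" "det (matrix (K' q)) \<noteq> 0"
  shows "p = q"
proof (rule ccontr)
  assume "p \<noteq> q"
  have lin: "linear (K' x)" for x using der has_derivative_linear by blast
  have contK: "continuous_on S K" for S
    using der by (meson continuous_at_imp_continuous_on has_derivative_continuous)
  obtain W1 W2 where W: "open W1" "open W2" "p \<in> W1" "q \<in> W2" "W1 \<inter> W2 = {}"
    using hausdorff[OF \<open>p \<noteq> q\<close>] by blast
  have injp: "K' p h = 0 \<Longrightarrow> h = 0" and injq: "K' q h = 0 \<Longrightarrow> h = 0" for h
    using z det_linear_nonzero_iff[OF lin] by blast+
  obtain U1 V1 g1 where U1: "open U1" "p \<in> U1" "U1 \<subseteq> W1" "open V1" "K p \<in> V1" "homeomorphism U1 V1 K g1"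
    using local_homeomorphism[OF der cont injp W(1,3)] by metis
  obtain U2 V2 g2 where U2: "open U2" "q \<in> U2" "U2 \<subseteq> W2" "open V2" "K q \<in> V2" "homeomorphism U2 V2 K g2"
    using local_homeomorphism[OF der cont injq W(2,4)] by metis
  have "open (V1 \<inter> V2)" "0 \<in> V1 \<inter> V2" using U1 U2 z by auto
  then obtain r0 where r0: "r0 > 0" "ball 0 r0 \<subseteq> V1 \<inter> V2"
    using open_contains_ball by blast
  \<comment> \<open>\<open>r0\<close> keeps the ball inside both local images, \<open>c\<close>
    makes the Jacobian nonnegative over it, and 1 keeps its preimage inside the unit ball, beyond
    which K is the identity.\<close>
  define r where "r = min r0 (min c 1)"
  have r: "r > 0" "r \<le> c" "r \<le> 1" "ball 0 r \<subseteq> V1" "ball 0 r \<subseteq> V2"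
    using r0 c by (auto simp: r_def)
  \<comment> \<open>Points of the cube then have l1 norm at most r / 2, which puts the cube inside
    the ball of radius r.\<close>
  define e where "e = r / (2 * real CARD('n))"
  have e: "e > 0" using r by (simp add: e_def)
  define Q where "Q = {y::real^'n::_. \<forall>i. \<bar>y $ i\<bar> < e}"
  have Qr: "norm y < r" if "y \<in> Q" for y
  proof -
    have "norm y \<le> (\<Sum>i\<in>UNIV. \<bar>y $ i\<bar>)" by (rule norm_le_l1_cart)
    also have "\<dots> \<le> (\<Sum>i\<in>(UNIV::'n::_ set). e)"
      using that by (intro sum_mono) (auto simp: Q_def less_imp_le)
    also have "\<dots> = r / 2" by (simp add: e_def)
    finally show ?thesis using r by linarith
  qed
  have Q0: "0 \<in> Q" using e by (simp add: Q_def)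
  have openQ: "open Q"
  proof -
    have "Q = (\<Inter>i. {y. \<bar>y $ i\<bar> < e})" by (auto simp: Q_def)
    then show ?thesis by (simp, intro open_INT ballI open_Collect_less continuous_intros) auto
  qed
  let ?\<psi> = "cubify e :: real^'n::_ \<Rightarrow> real^'n::_"
  let ?d = "\<lambda>x::real^'n::_. det (matrix (dcubify e x))"
  have d_nn: "?d x \<ge> 0" for x
    unfolding det_dcubify using dsig_bounds e by (intro prod_nonneg) auto
  have d_out: "?d x = 0" if "x \<notin> Q" for x
  proof -
    from that obtain i where "\<bar>x $ i\<bar> \<ge> e" by (auto simp: Q_def not_less)
    then have "dsig (x $ i / e) = 0" using e by (intro dsig_zero) (simp add: abs_divide le_divide_eq)
    then show ?thesis unfolding det_dcubify by (intro prod_zero) auto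
  qed
  have psi_inj: "inj_on ?\<psi> Q"
  proof (rule inj_onI)
    fix x y assume xy: "x \<in> Q" "y \<in> Q" "?\<psi> x = ?\<psi> y"
    have "x $ i / e = y $ i / e" for i
    proof (rule sig_inj)
      show "\<bar>x $ i / e\<bar> < 1" "\<bar>y $ i / e\<bar> < 1"
        using xy(1,2) e by (simp_all add: Q_def abs_divide)
      show "sig (x $ i / e) = sig (y $ i / e)"
        using arg_cong[OF xy(3), of "\<lambda>v. v $ i"] by (simp add: cubify_def)
    qed
    then show "x = y" using e by (simp add: vec_eq_iff)
  qed
  have dcub_cont: "continuous_on S (\<lambda>x. dcubify e (f x) (g x))"
    if "continuous_on S f" "continuous_on S g" for S and f g :: "real^'n::_ \<Rightarrow> real^'n::_"
    unfolding dcubify_def using e by (intro continuous_intros that continuous_on_vec_lambda) auto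
  define P where "P = ?\<psi> \<circ> K"
  define P' where "P' = (\<lambda>x. dcubify e (K x) \<circ> K' x)"
  have derP: "(P has_derivative P' x) (at x)" for x
    unfolding P_def P'_def by (rule diff_chain_at[OF der has_derivative_cubify])
  have contP: "continuous_on UNIV (\<lambda>x. P' x h)" for h
    unfolding P'_def o_def by (intro dcub_cont contK cont)
  have detP: "det (matrix (P' x)) = ?d (K x) * det (matrix (K' x))" for x
    unfolding P'_def by (simp add: matrix_compose[OF lin linear_dcubify] det_mul)
  \<comment> \<open>Off the cube the first factor vanishes, so the sign of the Jacobian of K matters
    only where |K x| < r <= c.\<close>
  have detP_nn: "det (matrix (P' x)) \<ge> 0" for x
    using nn[of x] d_nn[of "K x"] d_out[of "K x"] Qr[of "K x"] r by (cases "K x \<in> Q") (auto simp: detP)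
  have agree: "P x = ?\<psi> x" if "norm x \<ge> 1" for x using out[OF that] by (simp add: P_def)
  obtain L0 where L0: "L0 \<ge> 0" "\<And>x h. x \<in> cball 0 1 \<Longrightarrow> norm (K' x h) \<le> L0 * norm h"
    using continuous_derivative_bounded[OF lin continuous_on_subset[OF cont subset_UNIV] compact_cball] by metis
  have Kbd: "norm (K' x h) \<le> max L0 1 * norm h" for x h
  proof (cases "norm x \<le> 1")
    case True
    then have "norm (K' x h) \<le> L0 * norm h" using L0 by auto
    also have "\<dots> \<le> max L0 1 * norm h" by (intro mult_right_mono) auto
    finally show ?thesis .
  next
    case False
    have "(K has_derivative (\<lambda>h. h)) (at x)"
      by (rule has_derivative_transform_within_open[OF has_derivative_ident, of "- cball 0 1"])
        (use False out in auto)
    then have "K' x = (\<lambda>h. h)" using der has_derivative_unique by blast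
    then show ?thesis using mult_right_mono[of 1 "max L0 1" "norm h"] by simp
  qed
  have Pbd: "norm (P' x h) \<le> 2 / e * max L0 1 * norm h" for x h
  proof -
    have "norm (P' x h) \<le> 2 / e * norm (K' x h)" unfolding P'_def o_def by (rule norm_dcubify_le[OF e])
    also have "\<dots> \<le> 2 / e * (max L0 1 * norm h)" using e Kbd by (intro mult_left_mono) auto
    finally show ?thesis by (simp add: mult.assoc)
  qed
  have cd: "continuous_on UNIV (\<lambda>x. dcubify e x h)" for h :: "real^'n::_"
    by (intro dcub_cont continuous_intros)
  \<comment> \<open>Outside the ball K is the identity, so P agrees there with the squashing map and
    has the same Jacobian integral.\<close>
  have main: "integral (ball 0 1) (\<lambda>x. det (matrix (P' x))) = integral (ball 0 1) ?d"
    by (rule integral_det_eq_of_agree[where P = P and Q = ?\<psi> and P' = P' and Q' = "dcubify e"])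
      (fact derP contP Pbd has_derivative_cubify cd norm_dcubify_le[OF e] agree)+
  have contdet: "continuous_on UNIV (\<lambda>x. det (matrix (P' x)))"
    by (rule continuous_on_det) (auto simp: matrix_def intro!: continuous_intros contP)
  have contd: "continuous_on UNIV ?d"
    by (rule continuous_on_det) (auto simp: matrix_def intro!: continuous_intros cd)
  have int: "f integrable_on S" if "continuous_on UNIV f" "open S" "S \<subseteq> ball 0 1" for f :: "real^'n::_ \<Rightarrow> real" and S
    using that by (intro set_lebesgue_integral_eq_integral(1) absolutely_integrable_on_bounded)
      (auto intro: bounded_subset[OF bounded_ball])
  have Qb: "Q \<subseteq> ball 0 1" using Qr r by force
  define v where "v = measure lebesgue (?\<psi> ` Q)"
  have intQ: "integral Q ?d = v" and mQ: "?\<psi> ` Q \<in> lmeasurable"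
    using measure_differentiable_image_eq[OF _ has_derivative_at_withinI[OF has_derivative_cubify] psi_inj]
      measurable_differentiable_image_eq[OF _ has_derivative_at_withinI[OF has_derivative_cubify] psi_inj]
      openQ int[OF contd openQ Qb] d_nn
    by (simp_all add: v_def)
  have "open (?\<psi> ` Q)"
    by (rule invariance_of_domain[OF _ openQ psi_inj])
      (meson continuous_at_imp_continuous_on has_derivative_continuous has_derivative_cubify)
  then have "v \<noteq> 0"
    using Q0 mQ open_not_negligible[of "?\<psi> ` Q"] negligible_iff_measure0[OF mQ] by (auto simp: v_def)
  then have v: "v > 0" by (simp add: v_def zero_less_measure_iff)
  \<comment> \<open>K maps N bijectively onto the cube, so P maps N injectively onto the squashed
    cube: each zero contributes the whole volume v.\<close>
  have piece: "integral N (\<lambda>x. det (matrix (P' x))) = v \<and> open N \<and> N \<subseteq> ball 0 1"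
    if N: "N = U \<inter> K -` Q" and U: "open U" "homeomorphism U V K g" "ball 0 r \<subseteq> V" for N U V g
  proof -
    have opn: "open N" unfolding N using U(1) openQ contK[of UNIV] by (intro open_Int open_vimage)
    have sub: "N \<subseteq> ball 0 1"
    proof
      fix x assume "x \<in> N"
      then have "norm (K x) < 1" using Qb by (auto simp: N)
      then show "x \<in> ball 0 1" using out[of x] by (cases "norm x \<ge> 1") auto
    qed
    have KN: "K ` N = Q"
    proof -
      have "Q \<subseteq> V" using Qr U(3) by force
      then have "\<exists>x\<in>U. K x = y" if "y \<in> Q" for y using that U(2) unfolding homeomorphism_def by blast
      then show ?thesis by (force simp: N)
    qed
    have "inj_on K N" using U(2) unfolding N homeomorphism_def by (metis IntD1 inj_onI)
    then have iP: "inj_on P N" unfolding P_def using KN psi_inj by (simp add: comp_inj_on)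
    have "P ` N = ?\<psi> ` Q" unfolding P_def image_comp[symmetric] KN ..
    moreover have "(\<lambda>x. \<bar>det (matrix (P' x))\<bar>) integrable_on N" using int[OF contdet opn sub] detP_nn by simp
    ultimately have "integral N (\<lambda>x. \<bar>det (matrix (P' x))\<bar>) = v"
      using measure_differentiable_image_eq[OF _ has_derivative_at_withinI[OF derP] iP] opn by (simp add: v_def)
    then show ?thesis using detP_nn opn sub by simp
  qed
  let ?N1 = "U1 \<inter> K -` Q" and ?N2 = "U2 \<inter> K -` Q"
  note p1 = piece[OF refl U1(1) U1(6) r(4)] and p2 = piece[OF refl U2(1) U2(6) r(5)]
  have "?N1 \<inter> ?N2 = {}" using U1(3) U2(3) W(5) by auto
  then have "integral (?N1 \<union> ?N2) (\<lambda>x. det (matrix (P' x))) = 2 * v"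
    using p1 p2 int[OF contdet] by (subst integral_Un) auto
  moreover have "integral (?N1 \<union> ?N2) (\<lambda>x. det (matrix (P' x))) \<le> integral (ball 0 1) (\<lambda>x. det (matrix (P' x)))"
    using p1 p2 detP_nn by (intro integral_subset_le int[OF contdet]) auto
  moreover have "integral (ball 0 1) ?d = integral Q ?d"
  proof -
    have "integral (ball 0 1) ?d = integral (ball 0 1) (\<lambda>x. if x \<in> Q then ?d x else 0)"
      using d_out by (intro integral_cong) auto
    then show ?thesis using Qb by (simp add: integral_restrict_Int Int_absorb2)
  qed
  \<comment> \<open>The disjoint pieces around p and q force 2 v <= v.\<close>
  ultimately show False using main intQ v by simp
qed

section \<open>Smoothness of holomorphic maps\<close>

lemma norm_smult_vec: "norm (c *s v) = norm c * norm v" for v :: "complex^'n"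
  by (simp add: norm_vec_def norm_mult L2_set_right_distrib)

lemma norm_le_of_components:
  fixes x :: "complex^'n"
  assumes "\<And>j. norm (x $ j) \<le> B"
  shows "norm x \<le> real CARD('n) * B"
proof -
  have "norm x \<le> (\<Sum>j\<in>UNIV. norm (x $ j))"
    unfolding norm_vec_def by (rule L2_set_le_sum) simp
  also have "\<dots> \<le> (\<Sum>j\<in>(UNIV::'n set). B)"
    by (intro sum_mono assms)
  finally show ?thesis by simp
qed

lemma bounded_linear_smult_left: "bounded_linear (\<lambda>c. c *s v)" for v :: "complex^'n"
  by (rule bounded_linear_intro[where K = "norm v"])
    (auto simp: norm_smult_vec vec_eq_iff algebra_simps)

lemma holo_onI:
  assumes "\<And>z. z \<in> S \<Longrightarrow> (f has_derivative L z) (at z)" "\<And>z c v. z \<in> S \<Longrightarrow> L z (c *s v) = c *s L z v"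
  shows "holo_on f S"
  using assms unfolding holo_on_def by blast

lemma holo_on_has_derivative:
  assumes "holo_on f S" "z \<in> S"
  shows "(f has_derivative frechet_derivative f (at z)) (at z)"
    and "frechet_derivative f (at z) (c *s v) = c *s frechet_derivative f (at z) v"
proof -
  obtain L where L: "(f has_derivative L) (at z)" "\<And>c v. L (c *s v) = c *s L v"
    using assms unfolding holo_on_def by blast
  then have "L = frechet_derivative f (at z)"
    by (simp add: frechet_derivative_at)
  with L show "(f has_derivative frechet_derivative f (at z)) (at z)"
    "frechet_derivative f (at z) (c *s v) = c *s frechet_derivative f (at z) v" by auto
qed

lemma holo_on_subset: "holo_on f S \<Longrightarrow> T \<subseteq> S \<Longrightarrow> holo_on f T"
  unfolding holo_on_def by blast

lemma holo_on_continuous: "holo_on f S \<Longrightarrow> continuous_on S f"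
  by (meson continuous_at_imp_continuous_on has_derivative_continuous holo_on_has_derivative(1))

text \<open>Restriction to a complex line opens the way to one-variable Cauchy theory, component by
  component.\<close>

lemma holo_on_slice:
  assumes f: "holo_on f S" and w: "z + w *s v \<in> S"
  shows "((\<lambda>w. f (z + w *s v) $ j) has_field_derivative frechet_derivative f (at (z + w *s v)) v $ j) (at w)"
proof -
  let ?L = "frechet_derivative f (at (z + w *s v))"
  have "((\<lambda>w. z + w *s v) has_derivative (\<lambda>h. h *s v)) (at w)"
    using has_derivative_add[OF has_derivative_const bounded_linear_imp_has_derivative[OF bounded_linear_smult_left]]
    by simp
  then have "((\<lambda>w. f (z + w *s v)) has_derivative (\<lambda>h. ?L (h *s v))) (at w)"
    using holo_on_has_derivative(1)[OF f w] by (rule has_derivative_compose)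
  then have "((\<lambda>w. f (z + w *s v) $ j) has_derivative (\<lambda>h. ?L (h *s v) $ j)) (at w)"
    by (rule bounded_linear.has_derivative[OF bounded_linear_vec_nth])
  then show ?thesis
    unfolding has_field_derivative_def holo_on_has_derivative(2)[OF f w]
    by (simp add: mult_commute_abs)
qed

text \<open>Cauchy's inequality and Taylor's formula are applied on the complex line through z in
  direction v; the factor \<open>CARD('k)\<close> comes from summing components. About points of
  norm at most \<rho> / 2, discs of radius \<rho> / 2 still fit, so second derivatives are at most 2
  B / (\<rho> / 2)^2 = 8 B / \<rho>^2.\<close>

lemma holo_on_Cauchy_estimate:
  fixes f :: "complex^'n \<Rightarrow> complex^'k"
  assumes f: "holo_on f S" and \<rho>: "\<rho> > 0"
    and sub: "\<And>w. norm w \<le> \<rho> \<Longrightarrow> z + w *s v \<in> S"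
    and B: "\<And>w. norm w \<le> \<rho> \<Longrightarrow> norm (f (z + w *s v)) \<le> B"
  shows "norm (frechet_derivative f (at z) v) \<le> real CARD('k) * (B / \<rho>)"
    and "norm h \<le> \<rho> / 2 \<Longrightarrow> norm (f (z + h *s v) - f z - h *s frechet_derivative f (at z) v)
           \<le> real CARD('k) * (8 * B / \<rho>\<^sup>2 * (norm h)\<^sup>2)"
proof -
  let ?D = "frechet_derivative f (at z) v"
  define g where "g = (\<lambda>j w. f (z + w *s v) $ j)"
  have dg: "(g j has_field_derivative frechet_derivative f (at (z + w *s v)) v $ j) (at w)" if "norm w \<le> \<rho>" for j w
    unfolding g_def by (rule holo_on_slice[OF f sub[OF that]])
  have gB: "norm (g j w) \<le> B" if "norm w \<le> \<rho>" for j w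
    using B[OF that] Finite_Cartesian_Product.norm_nth_le[of "f (z + w *s v)" j] by (auto simp: g_def)
  have hol: "g j holomorphic_on ball 0 \<rho>" for j
    unfolding holomorphic_on_open[OF open_ball] using dg by (meson mem_ball_0 less_imp_le)
  have cont: "continuous_on (cball 0 \<rho>) (g j)" for j
    using dg by (auto intro!: continuous_at_imp_continuous_on DERIV_isCont)
  have d0: "deriv (g j) 0 = ?D $ j" for j
    using dg[of 0 j] \<rho> DERIV_imp_deriv by force
  have est: "norm ((deriv ^^ n) (g j) \<xi>) \<le> fact n * B / r ^ n" if "0 < r" "norm \<xi> + r \<le> \<rho>" for n j \<xi> r
  proof (rule Cauchy_inequality)
    have s: "cball \<xi> r \<subseteq> cball 0 \<rho>" "ball \<xi> r \<subseteq> ball 0 \<rho>"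
      using that by (simp_all add: cball_subset_cball_iff ball_subset_ball_iff)
    show "g j holomorphic_on ball \<xi> r" using hol s holomorphic_on_subset by blast
    show "continuous_on (cball \<xi> r) (g j)" using cont s continuous_on_subset by blast
    show "norm (g j x) \<le> B" if "norm (\<xi> - x) = r" for x
      using that s by (intro gB) (auto simp: dist_norm subset_iff)
  qed (use that in auto)
  show "norm ?D \<le> real CARD('k) * (B / \<rho>)"
  proof (rule norm_le_of_components)
    show "norm (?D $ j) \<le> B / \<rho>" for j
      using est[of \<rho> 0 1 j] \<rho> by (simp add: d0)
  qed
  assume h: "norm h \<le> \<rho> / 2"
  show "norm (f (z + h *s v) - f z - h *s ?D) \<le> real CARD('k) * (8 * B / \<rho>\<^sup>2 * (norm h)\<^sup>2)"
  proof (rule norm_le_of_components)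
    fix j
    have "norm ((deriv ^^ 0) (g j) h - (\<Sum>i\<le>1. (deriv ^^ i) (g j) 0 * (h - 0) ^ i / fact i))
        \<le> (8 * B / \<rho>\<^sup>2) * norm (h - 0) ^ Suc 1 / fact 1"
    proof (rule complex_Taylor)
      show "convex (cball (0::complex) (\<rho> / 2))" by simp
      fix x :: complex assume x: "x \<in> cball 0 (\<rho> / 2)"
      show "((deriv ^^ i) (g j) has_field_derivative (deriv ^^ Suc i) (g j) x) (at x within cball 0 (\<rho> / 2))" for i
        by (rule has_field_derivative_at_within[OF has_field_derivative_higher_deriv[OF hol open_ball]])
          (use x \<rho> in auto)
      show "norm ((deriv ^^ Suc 1) (g j) x) \<le> 8 * B / \<rho>\<^sup>2"
        using est[of "\<rho> / 2" x "Suc 1" j] x \<rho> by (simp add: power2_eq_square field_simps)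
    qed (use h \<rho> in auto)
    then show "norm ((f (z + h *s v) - f z - h *s ?D) $ j) \<le> 8 * B / \<rho>\<^sup>2 * (norm h)\<^sup>2"
      by (simp add: d0[unfolded g_def] g_def power2_eq_square algebra_simps)
  qed
qed

lemma frechet_derivative_diff_holo:
  assumes "holo_on f S" "holo_on g S" "z \<in> S"
  shows "frechet_derivative (\<lambda>x. f x - g x) (at z) v = frechet_derivative f (at z) v - frechet_derivative g (at z) v"
  using frechet_derivative_at[OF has_derivative_diff[OF holo_on_has_derivative(1)[OF assms(1,3)] holo_on_has_derivative(1)[OF assms(2,3)]]]
  by metis

lemma holo_on_diff:
  assumes "holo_on f S" "holo_on g S"
  shows "holo_on (\<lambda>x. f x - g x) S"
  unfolding holo_on_def
proof
  fix z assume z: "z \<in> S"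
  show "\<exists>L. ((\<lambda>x. f x - g x) has_derivative L) (at z) \<and> (\<forall>c v. L (c *s v) = c *s L v)"
    using has_derivative_diff[OF holo_on_has_derivative(1)[OF assms(1) z] holo_on_has_derivative(1)[OF assms(2) z]]
      holo_on_has_derivative(2)[OF assms(1) z] holo_on_has_derivative(2)[OF assms(2) z]
    by (intro exI conjI) (assumption, simp add: vec_eq_iff algebra_simps)
qed

text \<open>By the Cauchy estimate, maps uniformly close on the ball have uniformly close
  derivatives on the half ball. The derivatives therefore converge uniformly and the limit is
  differentiated termwise; complex homogeneity survives the limit.\<close>

lemma holo_on_uniform_limit:
  fixes f :: "nat \<Rightarrow> complex^'n \<Rightarrow> complex^'k"
  assumes r: "r > 0" and f: "\<And>k. holo_on (f k) (ball z0 r)"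
    and lim: "\<And>e. e > 0 \<Longrightarrow> \<forall>\<^sub>F k in sequentially. \<forall>z\<in>ball z0 r. norm (f k z - g z) \<le> e"
  shows "holo_on g (ball z0 (r / 2))"
proof -
  let ?D = "\<lambda>k z. frechet_derivative (f k) (at z)"
  \<comment> \<open>From the half ball there is room for displacements of norm r / 4, and two maps
    within e of the limit differ by at most 2 e; the quotient gives 8 / r.\<close>
  define C where "C = real CARD('k) * 8 / r"
  have C: "C > 0" using r by (simp add: C_def)
  have half: "ball z0 (r / 2) \<subseteq> ball z0 r" using r by (simp add: ball_subset_ball_iff)
  have lin: "bounded_linear (?D k z)" if "z \<in> ball z0 (r / 2)" for k z
    using holo_on_has_derivative(1)[OF f] that half has_derivative_bounded_linear by blast
  have cauchy: "norm (?D k z u - ?D l z u) \<le> C * e * norm u"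
    if z: "z \<in> ball z0 (r / 2)" and k: "\<forall>z\<in>ball z0 r. norm (f k z - g z) \<le> e"
      and l: "\<forall>z\<in>ball z0 r. norm (f l z - g z) \<le> e" for k l z u e
  proof (cases "u = 0")
    case True
    then show ?thesis using lin[OF z] by (simp add: linear_simps)
  next
    case False
    have sub: "z + w *s u \<in> ball z0 r" if "norm w \<le> r / 4 / norm u" for w :: complex
    proof -
      have "norm (w *s u) \<le> r / 4"
        using that False by (simp add: norm_smult_vec le_divide_eq)
      then show ?thesis
        using z r norm_triangle_ineq4[of "z0 - z" "w *s u"] by (simp add: dist_norm algebra_simps)
    qed
    have "norm (frechet_derivative (\<lambda>x. f k x - f l x) (at z) u) \<le> real CARD('k) * (2 * e / (r / 4 / norm u))"
    proof (rule holo_on_Cauchy_estimate(1)[OF holo_on_diff[OF f f] _ sub])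
      fix w :: complex assume w: "norm w \<le> r / 4 / norm u"
      let ?x = "z + w *s u"
      have "norm (f k ?x - f l ?x) \<le> norm (f k ?x - g ?x) + norm (f l ?x - g ?x)"
        using norm_triangle_ineq4[of "f k ?x - g ?x" "f l ?x - g ?x"] by simp
      then show "norm (f k ?x - f l ?x) \<le> 2 * e"
        using k l sub[OF w] by fastforce
    qed (use False r in auto)
    moreover have "z \<in> ball z0 r" using z half by blast
    ultimately show ?thesis
      using False by (simp add: frechet_derivative_diff_holo[OF f f] C_def field_simps)
  qed
  define g' where "g' = (\<lambda>z u. lim (\<lambda>k. ?D k z u))"
  have ev: "\<forall>\<^sub>F k in sequentially. \<forall>l\<ge>k. \<forall>z\<in>ball z0 r. norm (f l z - g z) \<le> e" if "e > 0" for e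
    using eventually_all_ge_at_top[OF lim[OF that]] .
  have conv: "(\<lambda>k. ?D k z u) \<longlonglongrightarrow> g' z u" if z: "z \<in> ball z0 (r / 2)" for z u
  proof -
    have "Cauchy (\<lambda>k. ?D k z u)"
    proof (rule metric_CauchyI)
      fix e :: real assume e: "e > 0"
      define d where "d = e / (2 * C * (norm u + 1))"
      have "norm u + 1 > 0" using norm_ge_zero[of u] by linarith
      then have d: "d > 0" "C * d * norm u < e"
        using e C by (auto simp: d_def field_simps add_strict_increasing)
      obtain K where "\<forall>l\<ge>K. \<forall>z\<in>ball z0 r. norm (f l z - g z) \<le> d"
        using eventually_happens[OF ev[OF d(1)]] by auto
      then show "\<exists>M. \<forall>m\<ge>M. \<forall>n\<ge>M. dist (?D m z u) (?D n z u) < e"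
        using cauchy[OF z, of _ d _ u] d(2) unfolding dist_norm by (meson le_less_trans)
    qed
    then show ?thesis unfolding g'_def by (simp add: Cauchy_convergent_iff convergent_LIMSEQ_iff)
  qed
  have unif: "\<forall>\<^sub>F k in sequentially. \<forall>z\<in>ball z0 (r / 2). \<forall>u. norm (?D k z u - g' z u) \<le> e * norm u" if "e > 0" for e
    using ev[of "e / C"]
  proof (rule eventually_mono)
    show "e / C > 0" using that C by simp
    fix k assume k: "\<forall>l\<ge>k. \<forall>z\<in>ball z0 r. norm (f l z - g z) \<le> e / C"
    show "\<forall>z\<in>ball z0 (r / 2). \<forall>u. norm (?D k z u - g' z u) \<le> e * norm u"
    proof (intro ballI allI)
      fix z u assume z: "z \<in> ball z0 (r / 2)"
      have "(\<lambda>l. norm (?D k z u - ?D l z u)) \<longlonglongrightarrow> norm (?D k z u - g' z u)"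
        by (intro tendsto_intros conv z)
      moreover have "norm (?D k z u - ?D l z u) \<le> e * norm u" if "l \<ge> k" for l
        using cauchy[OF z, of k "e / C" l u] k that C by simp
      ultimately show "norm (?D k z u - g' z u) \<le> e * norm u"
        by (intro LIMSEQ_le_const2) auto
    qed
  qed
  have glim: "(\<lambda>k. f k z) \<longlonglongrightarrow> g z" if "z \<in> ball z0 r" for z
  proof (rule metric_LIMSEQ_I)
    fix e :: real assume "e > 0"
    then show "\<exists>N. \<forall>n\<ge>N. dist (f n z) (g z) < e"
      using lim[of "e / 2"] that by (force simp: eventually_sequentially dist_norm)
  qed
  have "\<exists>g2. \<forall>x\<in>ball z0 (r / 2). (\<lambda>n. f n x) \<longlonglongrightarrow> g2 x \<and> (g2 has_derivative g' x) (at x within ball z0 (r / 2))"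
  proof (rule has_derivative_sequence[where f = f and f' = ?D and g' = g' and l = "g z0"])
    show "(f k has_derivative ?D k x) (at x within ball z0 (r / 2))" if "x \<in> ball z0 (r / 2)" for k x
      using that half by (blast intro: has_derivative_at_withinI[OF holo_on_has_derivative(1)[OF f]])
    show "(\<lambda>k. f k z0) \<longlonglongrightarrow> g z0" "z0 \<in> ball z0 (r / 2)" using glim r by auto
    show "convex (ball z0 (r / 2))" by (rule convex_ball)
  qed (rule unif)
  then obtain g2 where g2: "\<And>x. x \<in> ball z0 (r / 2) \<Longrightarrow> (\<lambda>n. f n x) \<longlonglongrightarrow> g2 x \<and> (g2 has_derivative g' x) (at x within ball z0 (r / 2))"
    by blast
  have "(g has_derivative g' x) (at x)" if x: "x \<in> ball z0 (r / 2)" for x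
  proof -
    have "(g2 has_derivative g' x) (at x)"
      using g2[OF x] unfolding at_within_open[OF x open_ball] ..
    moreover have "g2 y = g y" if "y \<in> ball z0 (r / 2)" for y
      using g2[OF that] glim[of y] that half LIMSEQ_unique by blast
    ultimately show ?thesis
      by (rule has_derivative_transform_within_open[OF _ open_ball x])
  qed
  moreover have "g' x (c *s v) = c *s g' x v" if x: "x \<in> ball z0 (r / 2)" for x c v
  proof (rule LIMSEQ_unique[OF conv[OF x]])
    have "(\<lambda>k. c *s ?D k x v) \<longlonglongrightarrow> c *s g' x v"
      unfolding vector_scalar_mult_def by (intro tendsto_vec_lambda tendsto_intros tendsto_vec_nth conv x)
    moreover have "x \<in> ball z0 r" using x half by blast
    ultimately show "(\<lambda>k. ?D k x (c *s v)) \<longlonglongrightarrow> c *s g' x v"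
      by (simp add: holo_on_has_derivative(2)[OF f])
  qed
  ultimately show ?thesis by (rule holo_onI)
qed

section \<open>Closure properties of holomorphic maps, and holomorphy of derivatives\<close>

lemma holo_on_compose:
  assumes f: "holo_on f S" and g: "holo_on g T" and sub: "\<And>z. z \<in> T \<Longrightarrow> g z \<in> S"
  shows "holo_on (\<lambda>z. f (g z)) T"
  by (rule holo_onI[where L = "\<lambda>z h. frechet_derivative f (at (g z)) (frechet_derivative g (at z) h)"])
    (use holo_on_has_derivative[OF f sub] holo_on_has_derivative[OF g] in \<open>auto intro: has_derivative_compose\<close>)

lemma holo_on_bounded_linear:
  assumes "bounded_linear L" "\<And>c v. L (c *s v) = c *s L v"
  shows "holo_on L S"
  by (rule holo_onI[where L = "\<lambda>z. L"]) (use assms in \<open>auto intro: bounded_linear_imp_has_derivative\<close>)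

lemma bounded_linear_smult_right: "bounded_linear (\<lambda>v::complex^'n. c *s v)"
  by (rule bounded_linear_intro[where K = "norm c"])
    (auto simp: norm_smult_vec vec_eq_iff algebra_simps)

lemma holo_on_add:
  assumes f: "holo_on f S" and g: "holo_on g S"
  shows "holo_on (\<lambda>z. f z + g z) S"
  by (rule holo_onI[where L = "\<lambda>z h. frechet_derivative f (at z) h + frechet_derivative g (at z) h"])
    (use holo_on_has_derivative[OF f] holo_on_has_derivative[OF g] in
      \<open>auto intro: has_derivative_add simp: vec_eq_iff algebra_simps\<close>)

lemma holo_on_const: "holo_on (\<lambda>z. c) S"
  by (rule holo_onI[where L = "\<lambda>z h. 0"]) auto

lemma holo_on_ident: "holo_on (\<lambda>z. z) S"
  by (rule holo_on_bounded_linear) auto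

lemma holo_on_smult:
  assumes "holo_on f S" shows "holo_on (\<lambda>z. c *s f z) S"
  by (rule holo_on_compose[OF holo_on_bounded_linear assms, where S = UNIV])
    (auto intro: bounded_linear_smult_right simp: vec_eq_iff)

lemma holo_on_coordinate_smult:
  fixes f :: "complex^'n \<Rightarrow> complex^'k"
  assumes f: "holo_on f S" and q: "\<And>z. z \<in> S \<Longrightarrow> (q has_field_derivative q' (z $ i)) (at (z $ i))"
  shows "holo_on (\<lambda>z. q (z $ i) *s f z) S"
proof (rule holo_onI)
  fix z assume z: "z \<in> S"
  let ?L = "\<lambda>h. q (z $ i) *s frechet_derivative f (at z) h + (h $ i * q' (z $ i)) *s f z"
  have bb: "bounded_bilinear (\<lambda>c v. c *s v :: complex^'k)"
    by (rule bounded_bilinear.intro)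
      (auto simp: vec_eq_iff algebra_simps norm_smult_vec intro!: exI[of _ 1])
  have "((\<lambda>z. q (z $ i)) has_derivative (\<lambda>h. h $ i * q' (z $ i))) (at z)"
    using has_derivative_compose[OF bounded_linear_imp_has_derivative[OF bounded_linear_vec_nth]
        q[OF z, unfolded has_field_derivative_def]]
    by (simp add: mult.commute)
  from bounded_bilinear.FDERIV[OF bb this holo_on_has_derivative(1)[OF f z]]
  show "((\<lambda>z. q (z $ i) *s f z) has_derivative ?L) (at z)" .
  show "?L (c *s v) = c *s ?L v" for c v
    by (simp add: holo_on_has_derivative(2)[OF f z] vec_eq_iff algebra_simps)
qed

text \<open>The second-order estimate bounds the error of a difference quotient by a multiple of the
  step, uniformly near a point, so the derivative is a locally uniform limit of holomorphic maps.
  Iterating this yields all higher derivatives.\<close>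

lemma holo_on_directional_derivative:
  fixes f :: "complex^'n \<Rightarrow> complex^'k"
  assumes f: "holo_on f S" and "open S"
  shows "holo_on (\<lambda>z. frechet_derivative f (at z) v) S"
proof -
  have "\<exists>r>0. holo_on (\<lambda>z. frechet_derivative f (at z) v) (ball z0 r)" if z0: "z0 \<in> S" for z0
  proof -
    obtain R where R: "R > 0" "cball z0 R \<subseteq> S"
      using \<open>open S\<close> z0 open_contains_cball by blast
    have "compact (f ` cball z0 R)"
      using holo_on_continuous[OF f] R continuous_on_subset by (intro compact_continuous_image) auto
    then obtain M where M: "\<And>x. x \<in> cball z0 R \<Longrightarrow> norm (f x) \<le> M"
      using compact_imp_bounded bounded_iff by (metis imageI)
    \<comment> \<open>Displacements up to \<rho> along v then have norm at most R / 2; the added 1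
      allows v = 0.\<close>
    define \<rho> where "\<rho> = R / (2 * (norm v + 1))"
    have nv: "norm v + 1 > 0" using norm_ge_zero[of v] by linarith
    then have \<rho>: "\<rho> > 0" "\<rho> * norm v \<le> R / 2"
      using R by (auto simp: \<rho>_def field_simps)
    have sub: "z + w *s v \<in> cball z0 R" if "z \<in> ball z0 (R / 2)" "norm w \<le> \<rho>" for z w
    proof -
      have "norm (w *s v) \<le> R / 2"
        using that mult_right_mono[of "norm w" \<rho> "norm v"] \<rho> by (simp add: norm_smult_vec)
      then show ?thesis
        using that norm_triangle_ineq4[of "z0 - z" "w *s v"] by (simp add: dist_norm algebra_simps)
    qed
    define h where "h = (\<lambda>k. \<rho> / 2 / real (Suc k))"
    have h: "h k > 0" "h k \<le> \<rho> / 2" for k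
      using \<rho> by (auto simp: h_def divide_le_eq)
    have h0: "h \<longlonglongrightarrow> 0"
      unfolding h_def using LIMSEQ_Suc[OF lim_const_over_n[of "\<rho> / 2"]] by simp
    define q where "q = (\<lambda>k z. (1 / complex_of_real (h k)) *s (f (z + complex_of_real (h k) *s v) - f z))"
    define C where "C = real CARD('k) * (8 * M / \<rho>\<^sup>2)"
    have est: "norm (q k z - frechet_derivative f (at z) v) \<le> C * h k" if z: "z \<in> ball z0 (R / 2)" for k z
    proof -
      let ?h = "complex_of_real (h k)" and ?D = "frechet_derivative f (at z) v"
      let ?e = "f (z + ?h *s v) - f z - ?h *s ?D"
      have "norm ?e \<le> real CARD('k) * (8 * M / \<rho>\<^sup>2 * (norm ?h)\<^sup>2)"
        by (rule holo_on_Cauchy_estimate(2)[OF f \<rho>(1)])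
          (use sub[OF z] R M h[of k] in \<open>auto simp: less_imp_le\<close>)
      then have "norm ?e / h k \<le> real CARD('k) * (8 * M / \<rho>\<^sup>2 * (norm ?h)\<^sup>2) / h k"
        using h(1)[of k] by (intro divide_right_mono) auto
      also have "\<dots> = C * h k"
        using h(1)[of k] by (simp add: C_def power2_eq_square)
      moreover have eq: "q k z - ?D = (1 / ?h) *s ?e"
        using h(1)[of k] by (simp add: q_def vec_eq_iff field_simps)
      have "norm (q k z - ?D) = norm ?e / h k"
        unfolding eq norm_smult_vec using h(1)[of k] by (simp add: norm_divide)
      ultimately show ?thesis by simp
    qed
    have "holo_on (\<lambda>z. frechet_derivative f (at z) v) (ball z0 (R / 2 / 2))"
    proof (rule holo_on_uniform_limit[where f = q])
      show "holo_on (q k) (ball z0 (R / 2))" for k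
        unfolding q_def
      proof (intro holo_on_smult holo_on_diff)
        show "holo_on f (ball z0 (R / 2))"
          using R by (intro holo_on_subset[OF f]) (auto simp: subset_iff)
        show "holo_on (\<lambda>z. f (z + complex_of_real (h k) *s v)) (ball z0 (R / 2))"
          by (rule holo_on_compose[OF f]) (use sub R h[of k] in \<open>auto intro!: holo_on_add holo_on_const holo_on_ident simp: less_imp_le\<close>)
      qed
      fix e :: real assume "e > 0"
      have "(\<lambda>k. C * h k) \<longlonglongrightarrow> C * 0" by (intro tendsto_intros h0)
      then have "\<forall>\<^sub>F k in sequentially. C * h k < e"
        using order_tendstoD(2) \<open>e > 0\<close> by force
      then show "\<forall>\<^sub>F k in sequentially. \<forall>z\<in>ball z0 (R / 2). norm (q k z - frechet_derivative f (at z) v) \<le> e"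
        by (rule eventually_mono) (meson est order_trans less_imp_le)
    qed (use R in auto)
    then show ?thesis using R by (intro exI[of _ "R / 2 / 2"]) auto
  qed
  then show ?thesis unfolding holo_on_def by (meson centre_in_ball)
qed

text \<open>Differentiating along \<open>\<iota> h\<close> keeps a map holomorphic, so iteration
  over the list of directions yields the derivative family that \<open>smooth_on\<close> asks for.
  On a set such as [0,1] x V the derivatives are restrictions from the ambient open set S.\<close>

lemma holo_on_smooth_on_compose:
  fixes f :: "complex^'n \<Rightarrow> complex^'k" and \<iota> :: "'a::real_normed_vector \<Rightarrow> complex^'n"
  assumes f: "holo_on f S" and S: "open S" and \<iota>: "bounded_linear \<iota>" and sub: "\<iota> ` T \<subseteq> S"
  shows "smooth_on T (\<lambda>x. f (\<iota> x))"
proof -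
  define G where "G = (\<lambda>vs. foldr (\<lambda>h g z. frechet_derivative g (at z) (\<iota> h)) vs f)"
  have holG: "holo_on (G vs) S" for vs
    by (induction vs) (auto simp: G_def f intro: holo_on_directional_derivative[OF _ S])
  have der: "((\<lambda>y. G vs (\<iota> y)) has_derivative (\<lambda>h. G (h # vs) (\<iota> x))) (at x within T)" if "x \<in> T" for vs x
  proof -
    have "((\<lambda>y. G vs (\<iota> y)) has_derivative (\<lambda>h. frechet_derivative (G vs) (at (\<iota> x)) (\<iota> h))) (at x)"
      using that sub by (intro has_derivative_compose[OF bounded_linear_imp_has_derivative[OF \<iota>]]
          holo_on_has_derivative(1)[OF holG]) auto
    then show ?thesis by (simp add: G_def has_derivative_at_withinI)
  qed
  show ?thesis
    unfolding smooth_on_def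
  proof (intro exI[of _ "\<lambda>k x vs. G vs (\<iota> x)"] conjI allI ballI impI)
    show "continuous_on T (\<lambda>x. G vs (\<iota> x))" for vs
      using der by (meson has_derivative_continuous_on)
  qed (use der in \<open>auto simp: G_def\<close>)
qed

section \<open>Complex-linear maps\<close>

definition parab :: "real \<Rightarrow> real \<Rightarrow> complex"
  where "parab l s = Complex s (l * s * (1 - s))"

lemma parab_01 [simp]: "parab l 0 = 0" "parab l 1 = 1"
  by (auto simp: parab_def complex_eq_iff)

lemma continuous_on_parab [continuous_intros]:
  "continuous_on S f \<Longrightarrow> continuous_on S (\<lambda>x. parab l (f x))"
  unfolding parab_def by (intro continuous_intros)

text \<open>Distinct parabolas from 0 to 1 meet only at their endpoints, so finitely many roots
  exclude only finitely many of them.\<close>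
lemma parabola_avoiding_roots:
  fixes p :: "complex poly"
  assumes "poly p 0 \<noteq> 0" "poly p 1 \<noteq> 0"
  obtains l where "\<And>s. s \<in> {0..1} \<Longrightarrow> poly p (parab l s) \<noteq> 0"
proof -
  have "p \<noteq> 0" using assms by auto
  \<comment> \<open>A root on the parabola with parameter l, away from its endpoints, determines l
    through this quotient.\<close>
  then have "finite ((\<lambda>w. Im w / (Re w * (1 - Re w))) ` {w. poly p w = 0})"
    by (intro finite_imageI poly_roots_finite)
  then obtain l where l: "l \<notin> (\<lambda>w. Im w / (Re w * (1 - Re w))) ` {w. poly p w = 0}"
    using ex_new_if_finite[OF infinite_UNIV_char_0] by blast
  have "poly p (parab l s) \<noteq> 0" if s: "s \<in> {0..1}" for s
  proof
    assume z: "poly p (parab l s) = 0"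
    with assms have "s \<noteq> 0" "s \<noteq> 1" by auto
    then have "Im (parab l s) / (Re (parab l s) * (1 - Re (parab l s))) = l"
      by (simp add: parab_def)
    with l z show False by (metis (mono_tags, lifting) imageI mem_Collect_eq)
  qed
  then show ?thesis using that by blast
qed

definition pencil :: "complex^'n^'n \<Rightarrow> complex^'n^'n \<Rightarrow> complex \<Rightarrow> complex^'n^'n"
  where "pencil M N t = (\<chi> i j. M $ i $ j + t * N $ i $ j)"

lemma poly_det_pencil: "poly (det (\<chi> i j. [:M $ i $ j, N $ i $ j:])) t = det (pencil M N t)"
  by (simp add: poly_det pencil_def)

lemma pencil_mult_vec: "pencil M N t *v x = M *v x + t *s (N *v x)"
  by (simp add: pencil_def vec_eq_iff matrix_vector_mult_def sum.distrib sum_distrib_left algebra_simps)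

lemma complex_det_nonzero_iff:
  "det A \<noteq> 0 \<longleftrightarrow> (\<forall>x. A *v x = 0 \<longrightarrow> x = 0)" for A :: "complex^'n^'n"
  by (metis invertible_det_nz invertible_left_inverse matrix_left_invertible_ker)

definition complex_linear :: "(complex^'n \<Rightarrow> complex^'k) \<Rightarrow> bool"
  where "complex_linear L \<longleftrightarrow> linear L \<and> (\<forall>c v. L (c *s v) = c *s L v)"

lemma complex_linear_imp_Vector_Spaces_linear:
  "complex_linear L \<Longrightarrow> Vector_Spaces.linear (*s) (*s) L"
  by (simp add: complex_linear_def linear_add Vector_Spaces.linear_iff vec.vector_space_axioms)

text \<open>The determinant of (1 - t) L + t M is a polynomial in complex t, nonzero at 0 and 1. Its
  roots may block the real segment but not every curve in the plane.\<close>

lemma complex_linear_path: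
  fixes L M :: "complex^'n \<Rightarrow> complex^'n"
  assumes L: "complex_linear L" "\<And>x. L x = 0 \<Longrightarrow> x = 0"
    and M: "complex_linear M" "\<And>x. M x = 0 \<Longrightarrow> x = 0"
  obtains l where "\<And>s x. s \<in> {0..1} \<Longrightarrow> (1 - parab l s) *s L x + parab l s *s M x = 0 \<Longrightarrow> x = 0"
proof -
  note l = complex_linear_imp_Vector_Spaces_linear
  let ?L = "matrix L" and ?M = "matrix M"
  let ?p = "det (\<chi> i j. [:?L $ i $ j, (?M - ?L) $ i $ j:])"
  have pen: "pencil ?L (?M - ?L) t *v x = (1 - t) *s L x + t *s M x" for t x
    unfolding pencil_mult_vec using matrix_works[OF l[OF L(1)]] matrix_works[OF l[OF M(1)]]
    by (simp add: matrix_vector_mult_diff_rdistrib vec_eq_iff algebra_simps)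
  have "poly ?p 0 \<noteq> 0" "poly ?p 1 \<noteq> 0"
    unfolding poly_det_pencil complex_det_nonzero_iff pen by (simp_all, (use L(2) M(2) in blast)+)
  then obtain l where "\<And>s. s \<in> {0..1} \<Longrightarrow> poly ?p (parab l s) \<noteq> 0"
    using parabola_avoiding_roots by blast
  then show ?thesis
    unfolding poly_det_pencil complex_det_nonzero_iff pen using that by blast
qed

text \<open>det (N + t M) is a polynomial in t that does not vanish at t = 0.\<close>
lemma complex_linear_perturb_invertible:
  fixes M N :: "complex^'n \<Rightarrow> complex^'n"
  assumes M: "complex_linear M" and N: "complex_linear N" "\<And>x. N x = 0 \<Longrightarrow> x = 0"
  shows "\<forall>\<^sub>F t in at_top. \<forall>x. M x + complex_of_real (1 / t) *s N x = 0 \<longrightarrow> x = 0"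
proof -
  note l = complex_linear_imp_Vector_Spaces_linear
  let ?M = "matrix M" and ?N = "matrix N"
  let ?p = "det (\<chi> i j. [:?N $ i $ j, ?M $ i $ j:])"
  have pen: "pencil ?N ?M t *v x = N x + t *s M x" for t x
    unfolding pencil_mult_vec using matrix_works[OF l[OF M(1)]] matrix_works[OF l[OF N(1)]] by simp
  have "poly ?p 0 \<noteq> 0"
    unfolding poly_det_pencil complex_det_nonzero_iff pen using N(2) by auto
  then have "?p \<noteq> 0" by auto
  then have "bounded (norm ` {w. poly ?p w = 0})"
    by (intro finite_imp_bounded finite_imageI poly_roots_finite)
  then obtain B where B: "\<And>w. poly ?p w = 0 \<Longrightarrow> norm w \<le> B"
    unfolding bounded_iff by auto
  have "\<forall>\<^sub>F t::real in at_top. max B 0 < t" by (rule eventually_gt_at_top)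
  then show ?thesis
  proof (rule eventually_mono)
    \<comment> \<open>The bound puts t beyond all roots of the determinant and, through the 0, keeps
      it nonzero for the factorization below.\<close>
    fix t :: real assume t: "max B 0 < t"
    then have "poly ?p (complex_of_real t) \<noteq> 0" using B[of "complex_of_real t"] by auto
    then have nz: "N x + complex_of_real t *s M x = 0 \<Longrightarrow> x = 0" for x
      unfolding poly_det_pencil complex_det_nonzero_iff pen by blast
    have "N x + complex_of_real t *s M x = complex_of_real t *s (M x + complex_of_real (1 / t) *s N x)" for x
      using t by (simp add: vec_eq_iff algebra_simps)
    then show "\<forall>x. M x + complex_of_real (1 / t) *s N x = 0 \<longrightarrow> x = 0"
      by (metis nz vector_smult_rzero)
  qed
qed

section \<open>Conjugation, the standard form J and orientation\<close>

definition cjv :: "complex^'n \<Rightarrow> complex^'n"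
  where "cjv z = (\<chi> i. cnj (z $ i))"

lemma norm_cjv [simp]: "norm (cjv z) = norm z"
  by (simp add: cjv_def norm_vec_def)

lemma linear_cjv: "linear cjv"
  by (rule linearI) (auto simp: cjv_def vec_eq_iff)

lemma bounded_linear_cjv: "bounded_linear cjv"
  using linear_cjv linear_linear by blast

text \<open>Conjugation turns the complex bilinear pairing of the radial condition into a real inner
  product, so tangency becomes orthogonality.\<close>

lemma inner_cjv: "inner (cjv a) b = Re (\<Sum>i\<in>UNIV. a $ i * b $ i)"
  by (simp add: inner_vec_def cjv_def inner_complex_def)

lemma OmegaJ_tangential: "(\<Sum>i\<in>UNIV. OmegaJ z $ i * z $ i) = 0" for z :: "complex^('m::finite \<times> 2)"
proof -
  have "(\<Sum>i\<in>UNIV. OmegaJ z $ i * z $ i) = (\<Sum>j\<in>UNIV. \<Sum>k\<in>UNIV. OmegaJ z $ (j, k) * z $ (j, k))"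
    by (simp add: sum.cartesian_product UNIV_Times_UNIV)
  also have "\<dots> = 0" by (simp add: sum_2 OmegaJ_def)
  finally show ?thesis .
qed

text \<open>Source of the trivial kernel of J and of the factorization G = J T with T = - J
  G.\<close>

lemma OmegaJ_OmegaJ: "OmegaJ (OmegaJ z) = - z"
proof -
  have "OmegaJ (OmegaJ z) $ (j, k) = - z $ (j, k)" for j k
    using exhaust_2[of k] by (auto simp: OmegaJ_def)
  then show ?thesis by (simp add: vec_eq_iff split_paired_all)
qed

lemma complex_linear_OmegaJ: "complex_linear OmegaJ"
  unfolding complex_linear_def by (auto intro!: linearI simp: OmegaJ_def vec_eq_iff)

text \<open>The change of variables theorem needs a wellordered index type, which is why the real
  coordinates are indexed by a numeral type.\<close>
lemma real_coordinates:
  obtains \<phi> :: "complex^('m::finite \<times> 2) \<Rightarrow> real^('m bit0 bit0)" and \<psi>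
  where "linear \<phi>" "linear \<psi>" "\<And>x. norm (\<phi> x) = norm x" "\<And>y. norm (\<psi> y) = norm y"
    "\<And>x. \<psi> (\<phi> x) = x" "\<And>y. \<phi> (\<psi> y) = y"
proof -
  have "DIM(complex^('m \<times> 2)) = DIM(real^('m bit0 bit0))" by simp
  then show ?thesis using isomorphisms_UNIV_UNIV that by blast
qed

context
  fixes \<phi> :: "'a::euclidean_space \<Rightarrow> real^'r" and \<psi>
  assumes lin: "linear \<phi>" "linear \<psi>" and inv: "\<And>x. \<psi> (\<phi> x) = x" "\<And>y. \<phi> (\<psi> y) = y"
begin

text \<open>As the coordinate maps are mutually inverse, the transported path starts at the identity
  matrix; it never becomes singular, so the determinant cannot change sign.\<close>

lemma det_transport_pos:
  fixes N :: "real \<Rightarrow> 'a \<Rightarrow> 'a"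
  assumes N: "\<And>s. s \<in> {0..1} \<Longrightarrow> linear (N s)" "N 0 = (\<lambda>v. v)"
    and ker: "\<And>s v. s \<in> {0..1} \<Longrightarrow> N s v = 0 \<Longrightarrow> v = 0"
    and cont: "\<And>v. continuous_on {0..1} (\<lambda>s. N s v)"
  shows "det (matrix (\<lambda>h. \<phi> (N 1 (\<psi> h)))) > 0"
proof -
  have zero: "\<phi> v = 0 \<Longrightarrow> v = 0" "\<psi> h = 0 \<Longrightarrow> h = 0" for v h
    using inv lin by (metis linear_0)+
  have c: "continuous_on {0..1} (\<lambda>s. \<phi> (N s v))" for v
    using continuous_on_compose2[OF linear_continuous_on cont] lin(1) linear_linear by blast
  show ?thesis
  proof (rule IVT_pos[where f = "\<lambda>s. det (matrix (\<lambda>h. \<phi> (N s (\<psi> h))))"])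
    show "continuous_on {0..1} (\<lambda>s. det (matrix (\<lambda>h. \<phi> (N s (\<psi> h)))))"
      by (rule continuous_on_det) (auto simp: matrix_def intro!: continuous_intros c)
    show "det (matrix (\<lambda>h. \<phi> (N 0 (\<psi> h)))) > 0"
      by (simp add: N(2) inv matrix_id_mat_1[unfolded id_def])
    fix s :: real assume s: "s \<in> {0..1}"
    have "linear (\<lambda>h. \<phi> (N s (\<psi> h)))"
      using linear_compose[OF linear_compose[OF lin(2) N(1)[OF s]] lin(1)] by (simp add: o_def)
    then show "det (matrix (\<lambda>h. \<phi> (N s (\<psi> h)))) \<noteq> 0"
      using ker[OF s] zero by (subst det_linear_nonzero_iff) blast+
  qed
qed

end

text \<open>The evenness of the dimension enters here: writing G = J T, the map T is joined to the
  identity by invertible complex-linear maps, and conj J v is orthogonal to v.\<close>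
lemma det_conjugate_complex_linear_nonneg:
  fixes \<phi> :: "complex^('m::finite \<times> 2) \<Rightarrow> real^'r"
  assumes \<phi>: "linear \<phi>" "linear \<psi>" "\<And>x. \<psi> (\<phi> x) = x" "\<And>y. \<phi> (\<psi> y) = y"
    and G: "complex_linear G"
  shows "det (matrix (\<lambda>h. \<phi> (cjv (G (\<psi> h))))) \<ge> 0"
proof (cases "\<forall>v. G v = 0 \<longrightarrow> v = 0")
  case False
  then obtain v where v: "G v = 0" "v \<noteq> 0" by blast
  have lin: "linear (\<lambda>h. \<phi> (cjv (G (\<psi> h))))"
    using linear_compose[OF linear_compose[OF linear_compose[OF \<phi>(2)] linear_cjv] \<phi>(1)] G
    by (auto simp: o_def complex_linear_def)
  have "\<phi> (cjv (G (\<psi> (\<phi> v)))) = 0"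
    by (simp add: \<phi>(3) v linear_0[OF \<phi>(1)] linear_0[OF linear_cjv])
  moreover have "\<phi> v \<noteq> 0"
    using v \<phi>(3)[of v] linear_0[OF \<phi>(2)] by auto
  ultimately show ?thesis
    using det_linear_nonzero_iff[OF lin] by force
next
  case True
  define T where "T = (\<lambda>v. - OmegaJ (G v))"
  have J: "linear OmegaJ" "\<And>c v. OmegaJ (c *s v) = c *s OmegaJ v"
    using complex_linear_OmegaJ by (auto simp: complex_linear_def)
  have T: "complex_linear T"
    using G J unfolding complex_linear_def T_def
    by (auto intro!: linearI simp: linear_add[OF J(1)] linear_cmul[OF J(1)] linear_add[of G] linear_cmul[of G])
  have GT: "G v = OmegaJ (T v)" for v
    by (simp add: T_def linear_neg[OF J(1)] OmegaJ_OmegaJ)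
  have Tker: "v = 0" if "T v = 0" for v using True GT[of v] that by (simp add: linear_0[OF J(1)])
  have Jker: "v = 0" if "OmegaJ v = 0" for v using OmegaJ_OmegaJ[of v] that by (simp add: linear_0[OF J(1)])
  obtain l where l: "\<And>s x. s \<in> {0..1} \<Longrightarrow> (1 - parab l s) *s x + parab l s *s T x = 0 \<Longrightarrow> x = 0"
    using complex_linear_path[of "\<lambda>x. x" T] T Tker by (auto simp: complex_linear_def linear_id[unfolded id_def])
  have 1: "det (matrix (\<lambda>h. \<phi> ((\<lambda>s x. (1 - parab l s) *s x + parab l s *s T x) 1 (\<psi> h)))) > 0"
  proof (rule det_transport_pos[OF \<phi>, where N = "\<lambda>s x. (1 - parab l s) *s x + parab l s *s T x"])
    show "linear (\<lambda>x. (1 - parab l s) *s x + parab l s *s T x)" for s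
      using T unfolding complex_linear_def
      by (auto intro!: linearI simp: linear_add[of T] linear_cmul[of T] vec_eq_iff algebra_simps)
    show "continuous_on {0..1} (\<lambda>s. (1 - parab l s) *s v + parab l s *s T v)" for v
      unfolding vector_scalar_mult_def by (intro continuous_intros)
    show "v = 0" if "s \<in> {0..1}" "(1 - parab l s) *s v + parab l s *s T v = 0" for s v
      using that by (rule l)
  qed simp
  have Jorth: "inner (cjv (OmegaJ v)) v = 0" for v :: "complex^('m \<times> 2)"
    by (simp add: inner_cjv OmegaJ_tangential)
  \<comment> \<open>The segment from the identity to conj J stays injective: pairing with v leaves
    (1 - s) |v|^2, and at s = 1 the map is the invertible conj J.\<close>
  have 2: "det (matrix (\<lambda>h. \<phi> ((\<lambda>s v. (1 - s) *\<^sub>R v + s *\<^sub>R cjv (OmegaJ v)) 1 (\<psi> h)))) > 0"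
  proof (rule det_transport_pos[OF \<phi>, where N = "\<lambda>s v. (1 - s) *\<^sub>R v + s *\<^sub>R cjv (OmegaJ v)"])
    show "linear (\<lambda>v::complex^('m \<times> 2). (1 - s) *\<^sub>R v + s *\<^sub>R cjv (OmegaJ v))" for s
      by (auto intro!: linearI simp: linear_add[OF J(1)] linear_cmul[OF J(1)]
          linear_add[OF linear_cjv] linear_cmul[OF linear_cjv] algebra_simps)
    show "continuous_on {0..1} (\<lambda>s. (1 - s) *\<^sub>R v + s *\<^sub>R cjv (OmegaJ v))" for v :: "complex^('m \<times> 2)"
      by (intro continuous_intros)
    fix s and v :: "complex^('m \<times> 2)" assume z: "(1 - s) *\<^sub>R v + s *\<^sub>R cjv (OmegaJ v) = 0"
    have "inner ((1 - s) *\<^sub>R v + s *\<^sub>R cjv (OmegaJ v)) v = (1 - s) * inner v v"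
      by (simp add: inner_add_left Jorth)
    with z have "s = 1 \<or> v = 0" by simp
    moreover have "v = 0" if "s = 1"
    proof -
      have "norm (OmegaJ v) = 0" using z that by (metis add.left_neutral diff_self norm_cjv norm_zero scaleR_one scaleR_zero_left)
      then show ?thesis using Jker by simp
    qed
    ultimately show "v = 0" by blast
  qed auto
  have "linear (\<lambda>h. \<phi> (cjv (OmegaJ (\<psi> h))))" "linear (\<lambda>h. \<phi> (T (\<psi> h)))"
    using linear_compose[OF linear_compose[OF linear_compose[OF \<phi>(2) J(1)] linear_cjv] \<phi>(1)]
      linear_compose[OF linear_compose[OF \<phi>(2)] \<phi>(1)] T
    by (auto simp: o_def complex_linear_def)
  then have "matrix ((\<lambda>h. \<phi> (cjv (OmegaJ (\<psi> h)))) \<circ> (\<lambda>h. \<phi> (T (\<psi> h))))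
      = matrix (\<lambda>h. \<phi> (cjv (OmegaJ (\<psi> h)))) ** matrix (\<lambda>h. \<phi> (T (\<psi> h)))"
    by (intro matrix_compose)
  then have "det (matrix (\<lambda>h. \<phi> (cjv (G (\<psi> h))))) = det (matrix (\<lambda>h. \<phi> (cjv (OmegaJ (\<psi> h))))) * det (matrix (\<lambda>h. \<phi> (T (\<psi> h))))"
    by (simp add: o_def \<phi> GT det_mul)
  then show ?thesis using 1 2 by simp
qed

section \<open>Zeros of tangential one-forms\<close>

text \<open>By Pythagoras the squared norm is at least (t^2 + (1 - t)^2) m^2, where t^2 + (1 - t)^2
  = 1/2 + 2 (t - 1/2)^2 >= 1/2; m / 2 is a convenient weaker bound.\<close>

lemma norm_convex_orthogonal_ge:
  fixes a b :: "'a::real_inner"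
  assumes orth: "inner a b = 0" and m: "m \<ge> 0" "norm a \<ge> m" "norm b \<ge> m"
  shows "norm (t *\<^sub>R a + (1 - t) *\<^sub>R b) \<ge> m / 2"
proof -
  have "(norm (t *\<^sub>R a + (1 - t) *\<^sub>R b))\<^sup>2 = t\<^sup>2 * (norm a)\<^sup>2 + (1 - t)\<^sup>2 * (norm b)\<^sup>2"
    using orth by (simp add: power2_norm_eq_inner inner_add_left inner_add_right inner_commute[of b a]
        power2_eq_square[of t] power2_eq_square[of "1 - t"])
  also have "\<dots> \<ge> t\<^sup>2 * m\<^sup>2 + (1 - t)\<^sup>2 * m\<^sup>2"
    using m by (intro add_mono mult_left_mono power_mono) auto
  also have "t\<^sup>2 * m\<^sup>2 + (1 - t)\<^sup>2 * m\<^sup>2 = (m / 2)\<^sup>2 + m\<^sup>2 * (1 / 4 + 2 * (t - 1 / 2)\<^sup>2)"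
    by (simp add: power2_eq_square algebra_simps)
  finally have "(m / 2)\<^sup>2 + m\<^sup>2 * (1 / 4 + 2 * (t - 1 / 2)\<^sup>2) \<le> (norm (t *\<^sub>R a + (1 - t) *\<^sub>R b))\<^sup>2" .
  moreover have "0 \<le> m\<^sup>2 * (1 / 4 + 2 * (t - 1 / 2)\<^sup>2)" by (intro mult_nonneg_nonneg add_nonneg_nonneg) auto
  ultimately have "(m / 2)\<^sup>2 \<le> (norm (t *\<^sub>R a + (1 - t) *\<^sub>R b))\<^sup>2" by linarith
  then show ?thesis by (rule power2_le_imp_le) simp
qed

text \<open>If A is tangential then conj A is orthogonal to the identity, so near the sphere conj F can
  be deformed to the identity without creating zeros. The degree of the resulting map is one.\<close>
lemma tangential_perturbation_zeros_unique:
  fixes A F :: "complex^('m::finite \<times> 2) \<Rightarrow> complex^('m \<times> 2)"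
  assumes U: "open U" "cball 0 1 \<subseteq> U" and F: "holo_on F U"
    and tang: "\<And>z. norm z \<le> 1 \<Longrightarrow> (\<Sum>i\<in>UNIV. A z $ i * z $ i) = 0"
    and r: "0 < r" "r < 1" and m: "0 < m" "m \<le> r"
    and A: "\<And>z. r \<le> norm z \<Longrightarrow> norm z \<le> 1 \<Longrightarrow> norm (A z) \<ge> m"
    and close: "\<And>z. norm z \<le> 1 \<Longrightarrow> norm (F z - A z) \<le> m / 4"
    and p: "norm p < r" "F p = 0" "\<And>v. frechet_derivative F (at p) v = 0 \<Longrightarrow> v = 0"
    and q: "norm q < r" "F q = 0" "\<And>v. frechet_derivative F (at q) v = 0 \<Longrightarrow> v = 0"
  shows "p = q"
proof -
  let ?D = "\<lambda>z. frechet_derivative F (at z)"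
  \<comment> \<open>Affine in |z|^2, with value -1 at radius r and 1 at radius 1, the interval on
    which \<open>sig\<close> varies. The square keeps it differentiable at 0, and \<open>cut\<close>
    halves \<open>sig\<close> because that rises from 0 to 2.\<close>
  define w where "w = (\<lambda>z::complex^('m \<times> 2). 2 * (((norm z)\<^sup>2 - r\<^sup>2) / (1 - r\<^sup>2)) - 1)"
  define cut where "cut = (\<lambda>z. sig (w z) / 2)"
  define dcut where "dcut = (\<lambda>z h. (4 * inner z h / (1 - r\<^sup>2)) * dsig (w z) / 2)"
  have r2: "1 - r\<^sup>2 > 0" using r by (simp add: power_less_one_iff abs_square_less_1)
  have w_le: "w z \<le> -1" if "norm z \<le> r" for z
  proof -
    have "(norm z)\<^sup>2 \<le> r\<^sup>2" using that by (intro power_mono) auto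
    then show ?thesis using r2 by (simp add: w_def divide_nonpos_pos)
  qed
  have w_ge: "w z \<ge> 1" if "norm z \<ge> 1" for z
  proof -
    have "(norm z)\<^sup>2 \<ge> 1\<^sup>2" using that by (intro power_mono) auto
    then show ?thesis using r2 by (simp add: w_def le_divide_eq)
  qed
  have chi_in: "cut z = 0" "dcut z h = 0" if "norm z \<le> r" for z h
    using w_le[OF that] by (auto simp: cut_def dcut_def sig_le dsig_zero)
  have chi_out: "cut z = 1" "dcut z h = 0" if "norm z \<ge> 1" for z h
    using w_ge[OF that] by (auto simp: cut_def dcut_def sig_ge dsig_zero)
  have der_chi: "(cut has_derivative dcut z) (at z)" for z
  proof -
    have "(w has_derivative (\<lambda>h. 2 * ((inner z h + inner h z) / (1 - r\<^sup>2)))) (at z)"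
      unfolding w_def power2_norm_eq_inner
      using r2 by (auto intro!: derivative_eq_intros)
    then have "((\<lambda>z. sig (w z)) has_derivative (\<lambda>h. (2 * ((inner z h + inner h z) / (1 - r\<^sup>2))) * dsig (w z))) (at z)"
      by (rule DERIV_compose_FDERIV[OF DERIV_sig])
    from bounded_linear.has_derivative[OF bounded_linear_divide[of 2] this] show ?thesis
      by (simp add: cut_def dcut_def inner_commute algebra_simps add_divide_distrib)
  qed
  have cont_chi: "continuous_on S cut" "continuous_on S (\<lambda>z. dcut z h)" for S h
  proof -
    show "continuous_on S cut"
      using der_chi by (meson continuous_at_imp_continuous_on has_derivative_continuous)
    show "continuous_on S (\<lambda>z. dcut z h)"
      unfolding dcut_def w_def using r2 by (intro continuous_intros) auto
  qed
  \<comment> \<open>conj F up to radius r, the identity from the unit sphere on, a convex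
    combination between. \<open>KU\<close> is the derivative on U; off U, where nothing is known
    about F, K is locally the identity and \<open>K'\<close> records this.\<close>
  define K where "K = (\<lambda>z. z + (1 - cut z) *\<^sub>R (cjv (F z) - z))"
  define KU where "KU = (\<lambda>z h. h + ((1 - cut z) *\<^sub>R (cjv (?D z h) - h) + (0 - dcut z h) *\<^sub>R (cjv (F z) - z)))"
  define K' where "K' = (\<lambda>z. if z \<in> U then KU z else (\<lambda>h. h))"
  have K_out: "K z = z" if "norm z \<ge> 1" for z using chi_out[OF that] by (simp add: K_def)
  have KU_out: "KU z h = h" if "norm z \<ge> 1" for z h using chi_out[OF that] by (simp add: KU_def)
  have K'_out: "K' z h = h" if "norm z \<ge> 1" for z h using KU_out[OF that] by (simp add: K'_def)
  have derK: "(K has_derivative K' z) (at z)" for z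
  proof (cases "z \<in> U")
    case True
    have "((\<lambda>z. cjv (F z)) has_derivative (\<lambda>h. cjv (?D z h))) (at z)"
      by (rule bounded_linear.has_derivative[OF bounded_linear_cjv holo_on_has_derivative(1)[OF F True]])
    then have "(K has_derivative KU z) (at z)"
      unfolding K_def KU_def
      by (intro has_derivative_add has_derivative_scaleR has_derivative_diff has_derivative_ident has_derivative_const der_chi)
    then show ?thesis using True by (simp add: K'_def)
  next
    case False
    then have z: "z \<in> - cball 0 1" using U by auto
    have "(K has_derivative (\<lambda>h. h)) (at z)"
      by (rule has_derivative_transform_within_open[OF has_derivative_ident _ z]) (use K_out in auto)
    then show ?thesis using False by (simp add: K'_def)
  qed
  have contK': "continuous_on UNIV (\<lambda>z. K' z h)" for h
  proof -
    have "continuous_on U (\<lambda>z. KU z h)"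
      unfolding KU_def
      using holo_on_continuous[OF F] holo_on_continuous[OF holo_on_directional_derivative[OF F U(1)]]
      by (intro continuous_intros cont_chi continuous_on_compose2[OF linear_continuous_on[OF bounded_linear_cjv]]) auto
    then have "continuous_on U (\<lambda>z. K' z h)"
      by (rule continuous_on_eq) (simp add: K'_def)
    moreover have "continuous_on (- cball 0 1) (\<lambda>z. K' z h)"
      by (rule continuous_on_eq[of _ "\<lambda>z. h"]) (auto simp: K'_out)
    ultimately have "continuous_on (U \<union> - cball 0 1) (\<lambda>z. K' z h)"
      using U(1) by (intro continuous_on_open_Un) auto
    moreover have "U \<union> - cball 0 1 = UNIV" using U(2) by auto
    ultimately show ?thesis by simp
  qed
  have inU: "z \<in> U" if "norm z \<le> r" for z using that r U(2) by auto
  have K_in: "K z = cjv (F z)" "K' z h = cjv (?D z h)" if "norm z \<le> r" for z h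
    using chi_in[OF that] inU[OF that] by (simp_all add: K_def K'_def KU_def)
  \<comment> \<open>Between radius r and 1 the vectors z and conj A z are orthogonal and of norm at
    least m, since m <= r; their combination has norm at least m / 2, and replacing A by F costs at
    most m / 4.\<close>
  have K_big: "norm (K z) \<ge> m / 4" if z: "norm z \<ge> r" for z
  proof (cases "norm z \<le> 1")
    case False
    then show ?thesis using K_out[of z] m r by auto
  next
    case True
    let ?L = "cut z *\<^sub>R z + (1 - cut z) *\<^sub>R cjv (A z)"
    have "inner z (cjv (A z)) = 0"
      using tang[OF True] by (simp add: inner_commute[of z] inner_cjv)
    then have 1: "norm ?L \<ge> m / 2"
      using m z A[OF z True] by (intro norm_convex_orthogonal_ge) auto
    have chi01: "0 \<le> cut z" "cut z \<le> 1" using sig_range by (auto simp: cut_def)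
    have "K z - ?L = (1 - cut z) *\<^sub>R cjv (F z - A z)"
      by (simp add: K_def linear_diff[OF linear_cjv] algebra_simps)
    then have "norm (K z - ?L) = (1 - cut z) * norm (F z - A z)"
      using chi01 by simp
    also have "\<dots> \<le> 1 * norm (F z - A z)" using chi01 by (intro mult_right_mono) auto
    also have "\<dots> \<le> m / 4" using close[OF True] by simp
    finally show ?thesis using 1 norm_triangle_ineq2[of ?L "?L - K z"] by (simp add: norm_minus_commute)
  qed
  obtain \<phi> :: "complex^('m \<times> 2) \<Rightarrow> real^('m bit0 bit0)" and \<psi>
    where c: "linear \<phi>" "linear \<psi>" "\<And>x. norm (\<phi> x) = norm x" "\<And>y. norm (\<psi> y) = norm y"
      "\<And>x. \<psi> (\<phi> x) = x" "\<And>y. \<phi> (\<psi> y) = y"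
    using real_coordinates by blast
  have bl: "bounded_linear \<phi>" "bounded_linear \<psi>" using c linear_linear by blast+
  define R where "R = (\<lambda>x. \<phi> (K (\<psi> x)))"
  define R' where "R' = (\<lambda>x h. \<phi> (K' (\<psi> x) (\<psi> h)))"
  have derR: "(R has_derivative R' x) (at x)" for x
    unfolding R_def R'_def
    by (rule bounded_linear.has_derivative[OF bl(1)])
      (rule has_derivative_compose[OF bounded_linear_imp_has_derivative[OF bl(2)] derK])
  have contR: "continuous_on UNIV (\<lambda>x. R' x h)" for h
    unfolding R'_def
    by (rule continuous_on_compose2[OF linear_continuous_on[OF bl(1)]])
      (rule continuous_on_compose2[OF contK' linear_continuous_on[OF bl(2)]], auto)
  have outR: "R x = x" if "norm x \<ge> 1" for x
    using that K_out[of "\<psi> x"] c by (simp add: R_def)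
  have clD: "complex_linear (?D z)" if "norm z \<le> r" for z
    using holo_on_has_derivative[OF F inU[OF that]] has_derivative_linear
    unfolding complex_linear_def by blast
  have detR: "matrix (R' x) = matrix (\<lambda>h. \<phi> (cjv (?D (\<psi> x) (\<psi> h))))" if "norm (\<psi> x) \<le> r" for x
    using K_in[OF that] by (simp add: R'_def)
  \<comment> \<open>Values below m / 4 occur only within radius r, where K is conj F.\<close>
  have nnR: "det (matrix (R' x)) \<ge> 0" if "norm (R x) < m / 4" for x
  proof -
    have "norm (\<psi> x) \<le> r" using that K_big[of "\<psi> x"] by (cases "r \<le> norm x") (simp_all add: R_def c)
    then show ?thesis
      using detR det_conjugate_complex_linear_nonneg[OF c(1,2,5,6) clD] by simp
  qed
  have zero: "R (\<phi> a) = 0 \<and> det (matrix (R' (\<phi> a))) \<noteq> 0"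
    if a: "norm a < r" "F a = 0" "\<And>v. ?D a v = 0 \<Longrightarrow> v = 0" for a
  proof
    have "norm a \<le> r" using a by simp
    have c0: "cjv (0 :: complex^('m \<times> 2)) = 0" by (rule linear_0[OF linear_cjv])
    show "R (\<phi> a) = 0"
      using K_in(1)[OF \<open>norm a \<le> r\<close>] a c0 by (simp add: R_def c linear_0[OF c(1)])
    have "linear (R' (\<phi> a))" using derR has_derivative_linear by blast
    moreover have "h = 0" if "R' (\<phi> a) h = 0" for h
    proof -
      have "norm (R' (\<phi> a) h) = norm (?D a (\<psi> h))"
        using K_in(2)[OF \<open>norm a \<le> r\<close>] by (simp add: R'_def c)
      then have "\<psi> h = 0" using that by - (rule a(3), simp)
      then show "h = 0" using c(4)[of h] by simp
    qed
    ultimately show "det (matrix (R' (\<phi> a))) \<noteq> 0" by (subst det_linear_nonzero_iff) blast+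
  qed
  have "\<phi> p = \<phi> q"
  proof (rule no_two_nondegenerate_zeros[OF derR contR outR])
    show "0 < m / 4" using m by simp
    show "det (matrix (R' x)) \<ge> 0" if "norm (R x) < m / 4" for x using that by (rule nnR)
    have z: "R (\<phi> p) = 0 \<and> det (matrix (R' (\<phi> p))) \<noteq> 0" "R (\<phi> q) = 0 \<and> det (matrix (R' (\<phi> q))) \<noteq> 0"
      by (rule zero[OF p(1,2)], erule p(3)) (rule zero[OF q(1,2)], erule q(3))
    then show "R (\<phi> p) = 0" "det (matrix (R' (\<phi> p))) \<noteq> 0" "R (\<phi> q) = 0" "det (matrix (R' (\<phi> q))) \<noteq> 0"
      by blast+
  qed
  then show ?thesis using c(5) by metis
qed

lemma norm_axis: "norm (axis i c) = norm c" for c :: complex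
proof -
  have "(\<Sum>j\<in>UNIV. (norm (axis i c $ j))\<^sup>2) = (\<Sum>j\<in>UNIV. if j = i then (norm c)\<^sup>2 else 0)"
    by (intro sum.cong) (auto simp: axis_def)
  then show ?thesis by (simp add: norm_vec_def L2_set_def)
qed

text \<open>At z = c e_i tangency reads c A_i(z) = 0, so A_i vanishes along the i-th axis near the
  origin, and continuity carries this to 0.\<close>

lemma tangential_zero:
  fixes A :: "complex^'n \<Rightarrow> complex^'n"
  assumes cont: "isCont A 0" and U: "open U" "0 \<in> U"
    and tang: "\<And>z. z \<in> U \<Longrightarrow> (\<Sum>i\<in>UNIV. A z $ i * z $ i) = 0"
  shows "A 0 = 0"
proof -
  have "A 0 $ i = 0" for i
  proof -
    let ?z = "\<lambda>n. axis i (complex_of_real (inverse (real (Suc n))))"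
    have lim: "?z \<longlonglongrightarrow> 0"
    proof (rule tendsto_norm_zero_cancel)
      show "(\<lambda>n. norm (?z n)) \<longlonglongrightarrow> 0"
        unfolding norm_axis norm_of_real using tendsto_rabs_zero[OF LIMSEQ_inverse_real_of_nat] .
    qed
    then have A: "(\<lambda>n. A (?z n) $ i) \<longlonglongrightarrow> A 0 $ i"
      using isCont_tendsto_compose[OF cont] tendsto_vec_nth by blast
    have "\<forall>\<^sub>F n in sequentially. ?z n \<in> U"
      using lim U topological_tendstoD by blast
    then have "\<forall>\<^sub>F n in sequentially. A (?z n) $ i = 0"
    proof (rule eventually_mono)
      fix n assume "?z n \<in> U"
      from tang[OF this] have "A (?z n) $ i * complex_of_real (inverse (real (Suc n))) = 0"
        by (simp add: axis_def if_distrib cong: if_cong)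
      then show "A (?z n) $ i = 0" by (simp del: of_nat_Suc)
    qed
    then have "(\<lambda>n. A (?z n) $ i) \<longlonglongrightarrow> 0" by (rule tendsto_eventually)
    then show ?thesis using A LIMSEQ_unique by blast
  qed
  then show ?thesis by (simp add: vec_eq_iff)
qed

text \<open>The zeros in the closed ball form a compact set off the sphere, so their norms stay
  below some r < 1, and |A| has a positive minimum on the remaining shell. The point 0 is adjoined
  to have a nonempty set; m is capped at r so that the identity map obeys the same bound on the
  shell.\<close>

lemma annulus_lower_bound:
  fixes A :: "complex^'n \<Rightarrow> complex^'k"
  assumes cont: "continuous_on (cball 0 1) A" and nz: "\<And>z. norm z = 1 \<Longrightarrow> A z \<noteq> 0"
  obtains r m where "0 < r" "r < 1" "0 < m" "m \<le> r"
    "\<And>z. r \<le> norm z \<Longrightarrow> norm z \<le> 1 \<Longrightarrow> norm (A z) \<ge> m"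
proof -
  define Z where "Z = {z \<in> cball 0 1. A z = 0}"
  have "closed Z"
    unfolding Z_def using continuous_closed_preimage[OF cont closed_cball, of "{0}"]
    by (simp add: vimage_def Int_def conj_commute)
  moreover have "bounded Z" by (rule bounded_subset[OF bounded_cball[of 0 1]]) (auto simp: Z_def)
  ultimately have "compact ({0} \<union> Z)"
    by (intro compact_Un) (simp_all add: compact_eq_bounded_closed)
  then obtain a where a: "a \<in> {0} \<union> Z" "\<And>z. z \<in> {0} \<union> Z \<Longrightarrow> norm z \<le> norm a"
    using continuous_attains_sup[OF _ _ continuous_on_norm_id, of "{0} \<union> Z"] by blast
  have a1: "norm a < 1" using a(1) nz by (cases "norm a = 1") (auto simp: Z_def)
  define r where "r = (1 + norm a) / 2"
  have r: "0 < r" "r < 1" "norm a < r" using a1 by (auto simp: r_def add_pos_nonneg)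
  let ?S = "cball 0 1 - ball 0 r :: (complex^'n) set"
  have "compact ?S" by (intro compact_diff) auto
  moreover have "continuous_on ?S (\<lambda>z. norm (A z))"
    by (intro continuous_intros continuous_on_subset[OF cont]) auto
  moreover have "axis undefined 1 \<in> ?S" using r by simp
  ultimately obtain b where b: "b \<in> ?S" "\<And>z. z \<in> ?S \<Longrightarrow> norm (A b) \<le> norm (A z)"
    using continuous_attains_inf[of ?S "\<lambda>z. norm (A z)"] by blast
  have "A b \<noteq> 0" using b(1) a(2)[of b] r by (auto simp: Z_def)
  then show ?thesis
    using r b that[of r "min r (norm (A b))"] by (simp add: min.coboundedI2)
qed

text \<open>A point where A is much smaller than the identity would allow A to be perturbed into a form
  with two nondegenerate zeros.\<close>
lemma tangential_lower_bound:
  fixes A :: "complex^('m::finite \<times> 2) \<Rightarrow> complex^('m \<times> 2)"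
  assumes U: "open U" "cball 0 1 \<subseteq> U" and A: "holo_on A U"
    and tang: "\<And>z. z \<in> U \<Longrightarrow> (\<Sum>i\<in>UNIV. A z $ i * z $ i) = 0"
    and nz: "\<And>z. norm z = 1 \<Longrightarrow> A z \<noteq> 0"
  obtains \<epsilon> where "\<epsilon> > 0" "\<And>z. norm z \<le> 1 \<Longrightarrow> norm (A z) \<ge> \<epsilon> * norm z"
proof -
  obtain r m where r: "0 < r" "r < 1" and m: "0 < m" "m \<le> r"
    and ann: "\<And>z. r \<le> norm z \<Longrightarrow> norm z \<le> 1 \<Longrightarrow> norm (A z) \<ge> m"
    using annulus_lower_bound[OF continuous_on_subset[OF holo_on_continuous[OF A] U(2)] nz] by metis
  have A0: "A 0 = 0"
    using tangential_zero[OF _ U(1) _ tang] U(2) has_derivative_continuous[OF holo_on_has_derivative(1)[OF A]]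
    by (simp add: subset_iff)
  have "norm (A p) \<ge> m / 8 * norm p" if p1: "norm p \<le> 1" for p
  proof (rule ccontr)
    assume "\<not> norm (A p) \<ge> m / 8 * norm p"
    then have small: "norm (A p) < m / 8 * norm p" by simp
    then have p0: "p \<noteq> 0" by auto
    have "norm p < r"
    proof (rule ccontr)
      assume "\<not> norm p < r"
      then have "m \<le> norm (A p)" using ann p1 by simp
      moreover have "m / 8 * norm p \<le> m / 8 * 1" using m p1 by (intro mult_left_mono) auto
      ultimately show False using small m by simp
    qed
    \<comment> \<open>The complex-linear functional of least norm, 1 / |p|, with value 1 at
      p.\<close>
    define pr where "pr = (\<lambda>z. (\<Sum>i\<in>UNIV. z $ i * cnj (p $ i)) / complex_of_real ((norm p)\<^sup>2))"
    have np: "norm p > 0" using p0 by simp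
    have pr_lin: "pr (x + y) = pr x + pr y" "pr (c *s x) = c * pr x" "pr 0 = 0" for x y c
      by (simp_all add: pr_def algebra_simps sum.distrib sum_distrib_left add_divide_distrib)
    have prp: "pr p = 1"
    proof -
      have "(\<Sum>i\<in>UNIV. p $ i * cnj (p $ i)) = complex_of_real (\<Sum>i\<in>UNIV. (norm (p $ i))\<^sup>2)"
        unfolding of_real_sum complex_norm_square ..
      also have "(\<Sum>i\<in>UNIV. (norm (p $ i))\<^sup>2) = (norm p)\<^sup>2"
        by (simp add: norm_vec_def L2_set_def sum_nonneg)
      finally show ?thesis using p0 by (simp add: pr_def)
    qed
    have pr_le: "norm (pr z) \<le> norm z / norm p" for z
    proof -
      have "norm (\<Sum>i\<in>UNIV. z $ i * cnj (p $ i)) \<le> (\<Sum>i\<in>UNIV. \<bar>norm (z $ i)\<bar> * \<bar>norm (p $ i)\<bar>)"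
        by (rule order_trans[OF norm_sum]) (simp add: norm_mult)
      also have "\<dots> \<le> norm z * norm p" unfolding norm_vec_def by (rule L2_set_mult_ineq)
      finally have "norm (\<Sum>i\<in>UNIV. z $ i * cnj (p $ i)) / (norm p)\<^sup>2 \<le> norm z * norm p / (norm p)\<^sup>2"
        by (intro divide_right_mono) auto
      then show ?thesis using np by (simp add: pr_def norm_divide norm_mult power2_eq_square)
    qed
    have pr_bl: "bounded_linear pr"
    proof (rule bounded_linear_intro[where K = "1 / norm p"])
      show "pr (r *\<^sub>R x) = r *\<^sub>R pr x" for r x
      proof -
        have "r *\<^sub>R x = complex_of_real r *s x"
          by (simp add: vec_eq_iff scaleR_conv_of_real[where 'a = complex])
        then show ?thesis using pr_lin(2) scaleR_conv_of_real by metis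
      qed
    qed (use pr_le pr_lin(1) in auto)
    \<comment> \<open>P is a quadratic map vanishing at 0 and p. Its derivative is the identity at
      0; at p it sends p to -p and fixes the kernel of \<open>pr\<close>. Both are
      invertible.\<close>
    define DP where "DP = (\<lambda>z u. u - (2 * pr z * pr u) *s p)"
    define P where "P = (\<lambda>z. z - (pr z * pr z) *s p)"
    have derP: "(P has_derivative DP z) (at z)" for z
    proof -
      have "((\<lambda>z. pr z * pr z) has_derivative (\<lambda>u. pr z * pr u + pr u * pr z)) (at z)"
        by (intro has_derivative_mult bounded_linear_imp_has_derivative pr_bl)
      from has_derivative_diff[OF has_derivative_ident bounded_linear.has_derivative[OF bounded_linear_smult_left this, of p]]
      show ?thesis by (simp add: P_def DP_def algebra_simps)
    qed
    have DP_cl: "DP z (c *s u) = c *s DP z u" for z c u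
      by (simp add: DP_def pr_lin vec_eq_iff algebra_simps)
    have DP_inj: "DP z u = 0 \<Longrightarrow> u = 0" if "z = 0 \<or> z = p" for z u
    proof -
      assume "DP z u = 0"
      then have u: "u = (2 * pr z * pr u) *s p" by (simp add: DP_def)
      then have "pr u = 2 * pr z * pr u" by (metis pr_lin(2) prp mult.right_neutral)
      then have "pr u = 0" using that prp pr_lin(3) by auto
      then show "u = 0" using u by simp
    qed
    \<comment> \<open>The linear correction makes p a zero and keeps the zero at 0. On the ball it
      costs at most |A p| / |p| < m / 8, which is where the smallness of A p relative to p
      enters.\<close>
    define F1 where "F1 = (\<lambda>z. A z - pr z *s A p)"
    have "holo_on (\<lambda>z. pr z *s A p) U"
      using bounded_linear_compose[OF bounded_linear_smult_left pr_bl]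
      by (intro holo_on_bounded_linear) (auto simp: pr_lin vec_eq_iff)
    then have F1: "holo_on F1 U" unfolding F1_def by (intro holo_on_diff A)
    have P: "holo_on P U" by (rule holo_onI[OF derP DP_cl])
    \<comment> \<open>\<open>F1\<close> may be degenerate at 0 or at p; a small multiple of P
      repairs both without moving these zeros.\<close>
    define F where "F = (\<lambda>t z. F1 z + complex_of_real (1 / t) *s P z)"
    have F: "holo_on (F t) U" for t unfolding F_def by (intro holo_on_add F1 holo_on_smult P)
    have inU: "0 \<in> U" "p \<in> U" using U(2) p1 by (auto simp: subset_iff)
    have DF: "frechet_derivative (F t) (at z) v = frechet_derivative F1 (at z) v + complex_of_real (1 / t) *s DP z v"
      if "z \<in> U" for z t v
    proof -
      have "(F t has_derivative (\<lambda>v. frechet_derivative F1 (at z) v + complex_of_real (1 / t) *s DP z v)) (at z)"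
        unfolding F_def
        by (intro has_derivative_add holo_on_has_derivative(1)[OF F1 that]
            bounded_linear.has_derivative[OF bounded_linear_smult_right] derP)
      from fun_cong[OF frechet_derivative_at[OF this], of v] show ?thesis by (rule sym)
    qed
    have cl: "complex_linear (frechet_derivative F1 (at z))" "complex_linear (DP z)" if "z \<in> U" for z
      using holo_on_has_derivative[OF F1 that] derP DP_cl has_derivative_linear
      unfolding complex_linear_def by blast+
    have ev: "\<forall>\<^sub>F t in at_top. \<forall>v. frechet_derivative (F t) (at z) v = 0 \<longrightarrow> v = 0" if "z = 0 \<or> z = p" for z
    proof -
      have "z \<in> U" using that inU by auto
      then show ?thesis
        using complex_linear_perturb_invertible[OF cl[OF \<open>z \<in> U\<close>] DP_inj[OF that]] by (simp add: DF)
    qed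
    have "\<forall>\<^sub>F t::real in at_top. 8 * (1 + 1 / norm p) / m < t" by (rule eventually_gt_at_top)
    then have "\<forall>\<^sub>F t::real in at_top. 8 * (1 + 1 / norm p) / m < t \<and> (\<forall>v. frechet_derivative (F t) (at 0) v = 0 \<longrightarrow> v = 0)
        \<and> (\<forall>v. frechet_derivative (F t) (at p) v = 0 \<longrightarrow> v = 0)"
      using ev[of 0] ev[of p] by (simp add: eventually_conj)
    \<comment> \<open>On the ball |P z| <= 1 + 1 / |p|, so this lower bound on t makes |P z| / t at
      most m / 8; together with the correction in \<open>F1\<close> the total stays within m /
      4.\<close>
    from eventually_happens'[OF trivial_limit_at_top_linorder this] obtain t where t: "8 * (1 + 1 / norm p) / m < t"
      and inj0: "\<And>v. frechet_derivative (F t) (at 0) v = 0 \<Longrightarrow> v = 0"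
      and injp: "\<And>v. frechet_derivative (F t) (at p) v = 0 \<Longrightarrow> v = 0"
      by blast
    have "0 \<le> 8 * (1 + 1 / norm p) / m" using m by simp
    then have tpos: "t > 0" using t by linarith
    have "0 = p"
    proof (rule tangential_perturbation_zeros_unique[OF U F _ r m ann])
      show "F t 0 = 0" "F t p = 0"
        by (simp_all add: F_def F1_def P_def pr_lin prp A0)
      show "norm (0 :: complex^('m \<times> 2)) < r" "norm p < r" using r \<open>norm p < r\<close> by simp_all
      show "v = 0" if "frechet_derivative (F t) (at 0) v = 0" for v using that by (rule inj0)
      show "v = 0" if "frechet_derivative (F t) (at p) v = 0" for v using that by (rule injp)
      fix z :: "complex^('m \<times> 2)" assume z: "norm z \<le> 1"
      show "(\<Sum>i\<in>UNIV. A z $ i * z $ i) = 0" using tang U(2) z by (simp add: subset_iff)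
      have pr1: "norm (pr z) \<le> 1 / norm p"
        using pr_le[of z] divide_right_mono[OF z, of "norm p"] by simp
      have "norm (F1 z - A z) = norm (pr z) * norm (A p)" by (simp add: F1_def norm_smult_vec)
      also have "\<dots> \<le> (1 / norm p) * (m / 8 * norm p)"
        using pr1 small np by (intro mult_mono) auto
      finally have 1: "norm (F1 z - A z) \<le> m / 8" using np by simp
      have "norm (pr z * pr z) \<le> (1 / norm p) * (1 / norm p)"
        unfolding norm_mult using pr1 np by (intro mult_mono) auto
      then have "norm (pr z * pr z) * norm p \<le> 1 / norm p * (1 / norm p) * norm p"
        by (intro mult_right_mono) auto
      then have "norm (P z) \<le> 1 + 1 / norm p"
        using norm_triangle_ineq4[of z "(pr z * pr z) *s p"] z np by (simp add: P_def norm_smult_vec)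
      then have "norm (P z) / t \<le> (1 + 1 / norm p) / t" using tpos by (simp add: divide_right_mono)
      also have "\<dots> \<le> m / 8" using t tpos m by (simp add: field_simps)
      finally have 2: "norm (complex_of_real (1 / t) *s P z) \<le> m / 8"
        using tpos by (simp add: norm_smult_vec norm_divide)
      have eq: "F t z - A z = (F1 z - A z) + complex_of_real (1 / t) *s P z" by (simp add: F_def)
      show "norm (F t z - A z) \<le> m / 4" unfolding eq
        using norm_triangle_ineq[of "F1 z - A z" "complex_of_real (1 / t) *s P z"] 1 2 by simp
    qed assumption
    then show False using p0 by simp
  qed
  then show ?thesis using that[of "m / 8"] m by simp
qed

section \<open>The homotopy\<close>

text \<open>Real time becomes an extra complex coordinate, indexed by \<open>None\<close>, so that
  joint smoothness follows from holomorphy on an open set of one more dimension.\<close>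

definition emb :: "real \<times> (complex^'n) \<Rightarrow> complex^('n option)"
  where "emb x = (\<chi> j. case j of None \<Rightarrow> complex_of_real (fst x) | Some i \<Rightarrow> snd x $ i)"

definition prj :: "complex^('n option) \<Rightarrow> complex^'n"
  where "prj x = (\<chi> i. x $ Some i)"

lemma emb_simps [simp]: "emb (s, z) $ None = complex_of_real s" "prj (emb (s, z)) = z"
  by (auto simp: emb_def prj_def vec_eq_iff)

lemma bounded_linear_emb: "bounded_linear (emb :: real \<times> (complex^'n) \<Rightarrow> _)"
proof -
  have "linear (emb :: real \<times> (complex^'n) \<Rightarrow> _)"
    by (rule linearI) (auto simp: emb_def vec_eq_iff scaleR_conv_of_real[where 'a = complex] split: option.splits)
  then show ?thesis by (rule linear_conv_bounded_linear[THEN iffD1])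
qed

lemma bounded_linear_prj: "bounded_linear prj"
proof -
  have "linear prj" by (rule linearI) (auto simp: prj_def vec_eq_iff)
  then show ?thesis by (rule linear_conv_bounded_linear[THEN iffD1])
qed

lemma prj_smult: "prj (c *s x) = c *s prj x"
  by (simp add: prj_def vec_eq_iff)

lemma holo_on_emb: "holo_on (\<lambda>z. emb (s, z)) S" for S :: "(complex^'n) set"
proof -
  have eq: "(\<lambda>z::complex^'n. emb (s, z)) = (\<lambda>z. emb (s, 0) + emb (0, z))"
    by (auto simp: emb_def vec_eq_iff split: option.splits)
  have "bounded_linear (\<lambda>z::complex^'n. emb (0, z))"
    by (rule bounded_linear_compose[OF bounded_linear_emb]) (intro bounded_linear_Pair bounded_linear_zero bounded_linear_ident)
  then have "holo_on (\<lambda>z::complex^'n. emb (0, z)) S"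
    by (rule holo_on_bounded_linear) (auto simp: emb_def vec_eq_iff split: option.splits)
  then show ?thesis
    unfolding eq by (intro holo_on_add holo_on_const)
qed

text \<open>The polynomial extension of \<open>parab l\<close> to complex time.\<close>

definition cparab :: "real \<Rightarrow> complex \<Rightarrow> complex"
  where "cparab l w = w + \<i> * complex_of_real l * w * (1 - w)"

lemma cparab_of_real: "cparab l (complex_of_real s) = parab l s"
  by (simp add: cparab_def parab_def complex_eq_iff)

text \<open>The straight family (1 - zeta) A + zeta J between the forms is applied to the rescaled
  coefficients A (tau z) / tau. Both parameters are polynomials in the time w, which makes the whole
  family holomorphic in (w, z).\<close>
definition family :: "(complex \<Rightarrow> complex) \<Rightarrow> real \<Rightarrow> (complex^('m::finite \<times> 2) \<Rightarrow> complex^('m \<times> 2))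
    \<Rightarrow> complex^(('m \<times> 2) option) \<Rightarrow> complex^('m \<times> 2)"
  where "family \<tau> l A x = ((1 - cparab l (x $ None)) / \<tau> (x $ None)) *s A (\<tau> (x $ None) *s prj x)
    + cparab l (x $ None) *s OmegaJ (prj x)"

lemma holo_on_family:
  fixes A :: "complex^('m::finite \<times> 2) \<Rightarrow> complex^('m \<times> 2)"
  assumes A: "holo_on A U" and \<tau>: "\<And>w. (\<tau> has_field_derivative \<tau>' w) (at w)"
  shows "holo_on (family \<tau> l A) {x. \<tau> (x $ None) \<noteq> 0 \<and> \<tau> (x $ None) *s prj x \<in> U}" (is "holo_on _ ?S")
proof -
  have prj: "holo_on prj T" for T :: "(complex^(('m \<times> 2) option)) set"
    by (rule holo_on_bounded_linear[OF bounded_linear_prj prj_smult])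
  have J: "holo_on OmegaJ T" for T :: "(complex^('m \<times> 2)) set"
    using complex_linear_OmegaJ linear_linear unfolding complex_linear_def by (intro holo_on_bounded_linear) blast+
  have cp: "(cparab l has_field_derivative 1 + \<i> * complex_of_real l * (1 - 2 * w)) (at w)" for w
    unfolding cparab_def by (auto intro!: derivative_eq_intros simp: algebra_simps)
  show ?thesis
    unfolding family_def
  proof (intro holo_on_add)
    have "holo_on (\<lambda>x. \<tau> (x $ None) *s prj x) ?S"
      by (rule holo_on_coordinate_smult[OF prj \<tau>])
    then have 1: "holo_on (\<lambda>x. A (\<tau> (x $ None) *s prj x)) ?S"
      by (rule holo_on_compose[OF A]) simp
    show "holo_on (\<lambda>x. ((1 - cparab l (x $ None)) / \<tau> (x $ None)) *s A (\<tau> (x $ None) *s prj x)) ?S"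
      by (rule holo_on_coordinate_smult[OF 1, where q = "\<lambda>w. (1 - cparab l w) / \<tau> w"])
        (rule DERIV_divide[OF DERIV_diff[OF DERIV_const cp] \<tau>], simp)
    show "holo_on (\<lambda>x. cparab l (x $ None) *s OmegaJ (prj x)) ?S"
      by (rule holo_on_coordinate_smult[OF holo_on_compose[OF J prj] cp]) auto
  qed
qed

lemma family_emb: "family \<tau> l A (emb (s, z)) = ((1 - parab l s) / \<tau> (complex_of_real s)) *s A (\<tau> (complex_of_real s) *s z)
    + parab l s *s OmegaJ z"
  by (simp add: family_def cparab_of_real)

text \<open>Rescaling by factors in (0,1] must not leave the domain, so U is shrunk to a ball.
  Compactness gives a margin e, and a point beyond the sphere is compared with its radial
  projection.\<close>

lemma ball_enlarge:
  fixes U :: "'a::euclidean_space set"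
  assumes "open U" "cball 0 1 \<subseteq> U"
  obtains e where "e > 0" "ball 0 (1 + e) \<subseteq> U"
proof -
  obtain e where e: "e > 0" "(\<Union>x\<in>cball 0 1. ball x e) \<subseteq> U"
    using compact_subset_open_imp_ball_epsilon_subset[OF compact_cball assms] by blast
  have "z \<in> U" if z: "norm z < 1 + e" for z
  proof (cases "norm z \<le> 1")
    case True
    then show ?thesis using assms(2) by auto
  next
    case False
    let ?y = "(1 / norm z) *\<^sub>R z"
    have eq: "?y - z = (1 / norm z - 1) *\<^sub>R z" by (simp add: algebra_simps)
    have n: "norm z > 1" using False by simp
    then have "1 / norm z \<le> 1" by (subst divide_le_eq_1_pos) linarith+
    then have "dist ?y z = (1 - 1 / norm z) * norm z" by (simp add: dist_norm eq)
    also have "\<dots> = norm z - 1" using n by (auto simp: left_diff_distrib)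
    finally have "dist ?y z = norm z - 1" .
    moreover have "norm ?y \<le> 1" using False by simp
    ultimately have "z \<in> ball ?y e" "?y \<in> cball 0 1" using z by simp_all
    then show ?thesis using e(2) by blast
  qed
  then show ?thesis using that e(1) by (auto simp: subset_iff)
qed

text \<open>Along a kernel vector v of B, A(t v) = o(t), against the linear lower bound.\<close>

lemma holo_derivative_at_zero_injective:
  fixes A :: "complex^'n \<Rightarrow> complex^'k"
  assumes der: "(A has_derivative B) (at 0)" and A0: "A 0 = 0" and \<epsilon>: "\<epsilon> > 0"
    and lower: "\<And>z. norm z \<le> 1 \<Longrightarrow> norm (A z) \<ge> \<epsilon> * norm z" and "B v = 0"
  shows "v = 0"
proof (rule ccontr)
  assume v: "v \<noteq> 0"
  obtain d where d: "d > 0" "\<And>y. norm y < d \<Longrightarrow> norm (A y - B y) \<le> \<epsilon> / 2 * norm y"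
    using der A0 \<epsilon> unfolding has_derivative_at_alt by (metis diff_zero half_gt_zero)
  define t where "t = min d 1 / (2 * norm v)"
  let ?y = "t *\<^sub>R v"
  have t: "t > 0" using d v by (simp add: t_def)
  have "norm ?y = min d 1 / 2" using d v by (simp add: t_def)
  then have y: "norm ?y < d" "norm ?y \<le> 1" using d(1) by auto
  have "B ?y = 0" using \<open>B v = 0\<close> has_derivative_linear[OF der] by (simp add: linear_cmul)
  then have "\<epsilon> * norm ?y \<le> \<epsilon> / 2 * norm ?y"
    using lower[OF y(2)] d(2)[OF y(1)] by simp
  then show False using \<epsilon> t v by simp
qed

theorem theorem1p5:
  fixes \<Omega> :: "complex^('m::finite \<times> 2) \<Rightarrow> complex^('m \<times> 2)"
    and U :: "(complex^('m \<times> 2)) set"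
  assumes "open U" and "cball 0 1 \<subseteq> U"
    and "holo_on \<Omega> U"
    and "\<forall>z\<in>U. radial_contr \<Omega> z = 0"
    and "\<forall>z\<in>sphere 0 1. \<Omega> z \<noteq> 0"
  shows "\<exists>V (\<Omega>s :: real \<Rightarrow> complex^('m \<times> 2) \<Rightarrow> complex^('m \<times> 2)).
           open V \<and> cball 0 1 \<subseteq> V \<and> V \<subseteq> U \<and>
           smooth_on ({0..1} \<times> V) (\<lambda>(s, z). \<Omega>s s z) \<and>
           (\<forall>z\<in>V. \<Omega>s 0 z = \<Omega> z) \<and>
           (\<forall>z\<in>V. \<Omega>s 1 z = OmegaJ z) \<and>
           (\<forall>s\<in>{0..1}. holo_on (\<Omega>s s) V \<and>
                         (\<forall>z\<in>V. radial_contr (\<Omega>s s) z = 0) \<and>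
                         (\<forall>z\<in>sphere 0 1. \<Omega>s s z \<noteq> 0))"
proof -
  have tang: "(\<Sum>i\<in>UNIV. \<Omega> z $ i * z $ i) = 0" if "z \<in> U" for z
    using assms(4) that by (simp add: radial_contr_def oneform_apply_def)
  obtain e where e: "e > 0" "ball 0 (1 + e) \<subseteq> U" using ball_enlarge[OF assms(1,2)] by blast
  define V where "V = (ball 0 (1 + e) :: (complex^('m \<times> 2)) set)"
  have V: "open V" "cball 0 1 \<subseteq> V" "V \<subseteq> U" using e by (auto simp: V_def)
  obtain \<epsilon> where \<epsilon>: "\<epsilon> > 0" "\<And>z. norm z \<le> 1 \<Longrightarrow> norm (\<Omega> z) \<ge> \<epsilon> * norm z"
    using tangential_lower_bound[OF assms(1-3) tang] assms(5) by (auto simp: sphere_def)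
  have zU: "0 \<in> U" using assms(2) by auto
  define B where "B = frechet_derivative \<Omega> (at 0)"
  have derB: "(\<Omega> has_derivative B) (at 0)" and Bc: "complex_linear B"
    using holo_on_has_derivative[OF assms(3) zU] has_derivative_linear
    unfolding B_def complex_linear_def by blast+
  have A0: "\<Omega> 0 = 0"
    by (rule tangential_zero[OF has_derivative_continuous[OF derB] assms(1) zU tang])
  have Bker: "v = 0" if "B v = 0" for v
    using holo_derivative_at_zero_injective[OF derB A0 \<epsilon> that] .
  have Jker: "v = 0" if "OmegaJ v = 0" for v :: "complex^('m \<times> 2)"
  proof -
    have "OmegaJ (0 :: complex^('m \<times> 2)) = 0" by (simp add: OmegaJ_def vec_eq_iff)
    then show ?thesis using OmegaJ_OmegaJ[of v] that by simp
  qed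
  have blJ: "bounded_linear (OmegaJ :: complex^('m \<times> 2) \<Rightarrow> _)" and blB: "bounded_linear B"
    using complex_linear_OmegaJ Bc unfolding complex_linear_def linear_conv_bounded_linear by blast+
  obtain l where l: "\<And>s x. s \<in> {0..1} \<Longrightarrow> (1 - parab l s) *s B x + parab l s *s OmegaJ x = 0 \<Longrightarrow> x = 0"
    using complex_linear_path[OF Bc Bker complex_linear_OmegaJ Jker] by metis
  let ?\<zeta> = "parab l"
  \<comment> \<open>The minimum of the linear path from B to J over [0,1] x sphere, positive because
    every member is injective.\<close>
  obtain \<kappa> where \<kappa>: "\<kappa> > 0" "\<And>s z. s \<in> {0..1} \<Longrightarrow> norm z = 1 \<Longrightarrow> norm ((1 - ?\<zeta> s) *s B z + ?\<zeta> s *s OmegaJ z) \<ge> \<kappa>"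
  proof -
    let ?S = "{0..1::real} \<times> sphere (0 :: complex^('m \<times> 2)) 1"
    let ?f = "\<lambda>x. norm ((1 - ?\<zeta> (fst x)) *s B (snd x) + ?\<zeta> (fst x) *s OmegaJ (snd x))"
    have "compact ?S" by (intro compact_Times) auto
    moreover have "(0, axis undefined 1) \<in> ?S" by simp
    moreover have "continuous_on ?S ?f"
      unfolding vector_scalar_mult_def
      by (intro continuous_intros continuous_on_compose2[OF linear_continuous_on[OF blB]]
          continuous_on_compose2[OF linear_continuous_on[OF blJ]]) auto
    ultimately obtain x where x: "x \<in> ?S" "\<And>y. y \<in> ?S \<Longrightarrow> ?f x \<le> ?f y"
      using continuous_attains_inf[of ?S ?f] by blast
    have "snd x \<noteq> 0" "fst x \<in> {0..1}" using x(1) by (auto simp: mem_Times_iff)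
    then have "?f x > 0" using l[of "fst x" "snd x"] by auto
    then show ?thesis
    proof (rule that)
      show "norm ((1 - ?\<zeta> s) *s B z + ?\<zeta> s *s OmegaJ z) \<ge> ?f x" if "s \<in> {0..1}" "norm z = 1" for s z
        using x(2)[of "(s, z)"] that by simp
    qed
  qed
  obtain C where C: "C > 0" "\<And>s. s \<in> {0..1} \<Longrightarrow> norm (1 - ?\<zeta> s) \<le> C"
  proof -
    have "compact ((\<lambda>s. 1 - ?\<zeta> s) ` {0..1})"
      by (intro compact_continuous_image continuous_intros) auto
    then show ?thesis using that compact_imp_bounded bounded_pos by (metis imageI)
  qed
  \<comment> \<open>Within radius d the deviation of \<open>\<Omega>\<close> from B, rescaled and
    multiplied by 1 - \<zeta>, costs at most \<kappa> / 2.\<close>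
  obtain d where d: "d > 0" "\<And>y. norm y < d \<Longrightarrow> norm (\<Omega> y - B y) \<le> \<kappa> / (2 * C) * norm y"
  proof -
    have "\<kappa> / (2 * C) > 0" using \<kappa> C by simp
    then show ?thesis
      using derB A0 that unfolding has_derivative_at_alt by (metis diff_zero)
  qed
  obtain C2 where C2: "C2 > 0" "\<And>z :: complex^('m \<times> 2). norm (OmegaJ z) \<le> norm z * C2"
    using bounded_linear.pos_bounded[OF blJ] by blast
  \<comment> \<open>Before time \<eta> the rescaled form, of norm at least \<epsilon> on the sphere
    at every scale, outweighs the J term.\<close>
  obtain \<eta> where \<eta>: "0 < \<eta>" "\<eta> < 1" "\<And>s. 0 \<le> s \<Longrightarrow> s < \<eta> \<Longrightarrow> norm (?\<zeta> s) * C2 < norm (1 - ?\<zeta> s) * \<epsilon>"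
  proof -
    let ?g = "\<lambda>s. norm (1 - ?\<zeta> s) * \<epsilon> - norm (?\<zeta> s) * C2"
    have "continuous_on UNIV ?g" by (intro continuous_intros)
    then have "isCont ?g 0" by (simp add: continuous_on_eq_continuous_at)
    then have "\<forall>\<^sub>F s in at 0. ?g s > 0"
      using \<epsilon> unfolding isCont_def by (intro order_tendstoD(1)) auto
    then obtain b where b: "b > 0" "\<And>s. s \<noteq> 0 \<Longrightarrow> \<bar>s\<bar> < b \<Longrightarrow> ?g s > 0"
      unfolding eventually_at by (auto simp: dist_real_def)
    show ?thesis
    proof (rule that[of "min b 1 / 2"])
      show "0 < min b 1 / 2" "min b 1 / 2 < 1" using b(1) by auto
      fix s :: real assume "0 \<le> s" "s < min b 1 / 2"
      then show "norm (?\<zeta> s) * C2 < norm (1 - ?\<zeta> s) * \<epsilon>"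
        using b(2)[of s] \<epsilon> b(1) by (cases "s = 0") auto
    qed
  qed
  define \<delta> where "\<delta> = min d 1 / 2"
  have \<delta>: "0 < \<delta>" "\<delta> < 1" "2 * \<delta> \<le> d" using d(1) by (auto simp: \<delta>_def)
  \<comment> \<open>The high power brings \<tau> below 2 \<delta> <= d from time \<eta> on, so the
    rescaled sphere lies where \<open>\<Omega>\<close> is close to B.\<close>
  obtain k where k: "(1 - \<eta>) ^ k < \<delta>"
    using real_arch_pow_inv[of \<delta> "1 - \<eta>"] \<eta> \<delta> by auto
  \<comment> \<open>\<tau> decreases from 1 only to \<delta> > 0, so division by it makes sense on
    all of [0,1]; being polynomial it extends to complex time as \<open>\<tau>c\<close>.\<close>
  define \<tau> where "\<tau> = (\<lambda>s::real. \<delta> + (1 - \<delta>) * (1 - s) ^ Suc k)"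
  define \<tau>c where "\<tau>c = (\<lambda>w::complex. of_real \<delta> + (1 - of_real \<delta>) * (1 - w) ^ Suc k)"
  have \<tau>c: "\<tau>c (complex_of_real s) = complex_of_real (\<tau> s)" for s
    by (simp add: \<tau>_def \<tau>c_def)
  have \<tau>01: "\<tau> 0 = 1" "\<tau> s > 0" "\<tau> s \<le> 1" if "s \<in> {0..1}" for s
  proof -
    show "\<tau> 0 = 1" by (simp add: \<tau>_def)
    have p: "0 \<le> (1 - s) ^ Suc k" "(1 - s) ^ Suc k \<le> 1"
      using that by (auto intro!: zero_le_power power_le_one simp del: power_Suc)
    have "0 \<le> (1 - \<delta>) * (1 - s) ^ Suc k" using p \<delta> by (intro mult_nonneg_nonneg) auto
    then show "\<tau> s > 0" using \<delta> by (simp add: \<tau>_def)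
    have "(1 - \<delta>) * (1 - s) ^ Suc k \<le> (1 - \<delta>) * 1" using p \<delta> by (intro mult_left_mono) auto
    then show "\<tau> s \<le> 1" by (simp add: \<tau>_def)
  qed
  have \<tau>_small: "\<tau> s < d" if "\<eta> \<le> s" "s \<le> 1" for s
  proof -
    have "(1 - s) ^ Suc k \<le> (1 - \<eta>) ^ Suc k" using that by (intro power_mono) auto
    also have "\<dots> \<le> (1 - \<eta>) ^ k" using \<eta> by (simp add: mult_left_le_one_le)
    finally have "(1 - \<delta>) * (1 - s) ^ Suc k \<le> (1 - \<delta>) * (1 - \<eta>) ^ k"
      using \<delta> by (intro mult_left_mono) auto
    also have "\<dots> \<le> 1 * (1 - \<eta>) ^ k" using \<delta> \<eta> by (intro mult_right_mono) auto
    finally show ?thesis using k \<delta> by (simp add: \<tau>_def)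
  qed
  have der\<tau>c: "(\<tau>c has_field_derivative (1 - of_real \<delta>) * (of_nat (Suc k) * (1 - w) ^ k * (0 - 1))) (at w)" for w
    unfolding \<tau>c_def by (auto intro!: derivative_eq_intros simp del: of_nat_Suc power_Suc)
  have cont\<tau>c: "continuous_on S \<tau>c" for S
    unfolding \<tau>c_def by (intro continuous_intros)
  define \<Phi> where "\<Phi> = family \<tau>c l \<Omega>"
  define \<Omega>s where "\<Omega>s = (\<lambda>s z. \<Phi> (emb (s, z)))"
  define G where "G = {x. \<tau>c (x $ None) \<noteq> 0 \<and> \<tau>c (x $ None) *s prj x \<in> U}"
  have hol: "holo_on \<Phi> G"
    unfolding \<Phi>_def G_def by (rule holo_on_family[OF assms(3) der\<tau>c])
  have "open G"
  proof -
    have c: "continuous_on UNIV (\<lambda>x::complex^(('m \<times> 2) option). \<tau>c (x $ None))"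
      by (rule continuous_on_compose2[OF cont\<tau>c]) (auto intro: continuous_intros)
    have "continuous_on UNIV (\<lambda>x::complex^(('m \<times> 2) option). \<tau>c (x $ None) *s prj x)"
      unfolding vector_scalar_mult_def
      by (intro continuous_intros c linear_continuous_on[OF bounded_linear_prj])
    then have "open {x::complex^(('m \<times> 2) option). \<tau>c (x $ None) \<noteq> 0}"
      "open ((\<lambda>x::complex^(('m \<times> 2) option). \<tau>c (x $ None) *s prj x) -` U)"
      using open_Collect_neq[OF c continuous_on_const] open_vimage[OF assms(1)] by blast+
    then have "open ({x::complex^(('m \<times> 2) option). \<tau>c (x $ None) \<noteq> 0}
        \<inter> (\<lambda>x. \<tau>c (x $ None) *s prj x) -` U)"
      by (rule open_Int)
    then show ?thesis by (simp add: G_def vimage_def Int_def)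
  qed
  have scaled: "complex_of_real (\<tau> s) *s z \<in> V" if "s \<in> {0..1}" "z \<in> V" for s z
  proof -
    have "\<tau> s * norm z \<le> 1 * norm z" using \<tau>01[OF that(1)] by (intro mult_right_mono) auto
    then show ?thesis using that(2) \<tau>01(2)[OF that(1)] by (simp add: V_def norm_smult_vec)
  qed
  have in_G: "emb (s, z) \<in> G" if "s \<in> {0..1}" "z \<in> V" for s z
    using scaled[OF that] V(3) \<tau>01(2)[OF that(1)] by (auto simp: G_def \<tau>c)
  have \<Omega>s_eq: "\<Omega>s s z = ((1 - ?\<zeta> s) / complex_of_real (\<tau> s)) *s \<Omega> (complex_of_real (\<tau> s) *s z) + ?\<zeta> s *s OmegaJ z" for s z
    by (simp add: \<Omega>s_def \<Phi>_def family_emb \<tau>c)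
  have "smooth_on ({0..1} \<times> V) (\<lambda>x. \<Phi> (emb x))"
    by (rule holo_on_smooth_on_compose[OF hol \<open>open G\<close> bounded_linear_emb]) (use in_G in auto)
  moreover have "(\<lambda>x. \<Phi> (emb x)) = (\<lambda>(s, z). \<Omega>s s z)" by (auto simp: \<Omega>s_def)
  ultimately have smooth: "smooth_on ({0..1} \<times> V) (\<lambda>(s, z). \<Omega>s s z)" by simp
  have hol_s: "holo_on (\<Omega>s s) V" if "s \<in> {0..1}" for s
    unfolding \<Omega>s_def using in_G[OF that] by (intro holo_on_compose[OF hol holo_on_emb])
  have rad: "radial_contr (\<Omega>s s) z = 0" if s: "s \<in> {0..1}" and z: "z \<in> V" for s z
  proof -
    let ?t = "complex_of_real (\<tau> s)"
    have t: "?t \<noteq> 0" using \<tau>01(2)[OF s] by simp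
    have "(\<Sum>i\<in>UNIV. \<Omega> (?t *s z) $ i * (?t *s z) $ i) = 0"
      using scaled[OF s z] V(3) tang by blast
    then have "?t * (\<Sum>i\<in>UNIV. \<Omega> (?t *s z) $ i * z $ i) = 0"
      by (simp add: sum_distrib_left mult.left_commute)
    then have 1: "(\<Sum>i\<in>UNIV. \<Omega> (?t *s z) $ i * z $ i) = 0" using t by simp
    have "radial_contr (\<Omega>s s) z = (1 - ?\<zeta> s) / ?t * (\<Sum>i\<in>UNIV. \<Omega> (?t *s z) $ i * z $ i)
        + ?\<zeta> s * (\<Sum>i\<in>UNIV. OmegaJ z $ i * z $ i)"
      by (simp add: radial_contr_def oneform_apply_def \<Omega>s_eq distrib_right sum.distrib sum_distrib_left mult.assoc)
    then show ?thesis by (simp add: 1 OmegaJ_tangential)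
  qed
  have nz: "\<Omega>s s z \<noteq> 0" if s: "s \<in> {0..1}" and z: "norm z = 1" for s z
  proof
    assume zero: "\<Omega>s s z = 0"
    let ?t = "complex_of_real (\<tau> s)"
    let ?A = "(1 / ?t) *s \<Omega> (?t *s z)"
    note t = \<tau>01(2,3)[OF s]
    have ny: "norm (?t *s z) = \<tau> s" using t z by (simp add: norm_smult_vec)
    have eq: "\<Omega>s s z = (1 - ?\<zeta> s) *s ?A + ?\<zeta> s *s OmegaJ z"
      by (simp add: \<Omega>s_eq)
    show False
    proof (cases "s < \<eta>")
      case True
      have "\<epsilon> * \<tau> s \<le> norm (\<Omega> (?t *s z))" using \<epsilon>(2)[of "?t *s z"] ny t by simp
      then have "\<epsilon> \<le> norm ?A"
        using t by (simp add: norm_smult_vec norm_divide le_divide_eq)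
      then have "norm (1 - ?\<zeta> s) * \<epsilon> \<le> norm ((1 - ?\<zeta> s) *s ?A)"
        unfolding norm_smult_vec[of "1 - ?\<zeta> s"] by (intro mult_left_mono) auto
      also have "(1 - ?\<zeta> s) *s ?A = - (?\<zeta> s *s OmegaJ z)"
        using zero eq by (simp add: eq_neg_iff_add_eq_0)
      also have "norm \<dots> \<le> norm (?\<zeta> s) * C2"
        using C2(2)[of z] z by (simp add: norm_smult_vec mult_left_mono)
      finally show False using \<eta>(3)[of s] s True by simp
    next
      case False
      then have "norm (?t *s z) < d" using \<tau>_small[of s] s ny by simp
      from d(2)[OF this] have le: "norm (\<Omega> (?t *s z) - B (?t *s z)) \<le> \<kappa> / (2 * C) * \<tau> s"
        using ny by simp
      have "?A - B z = (1 / ?t) *s (\<Omega> (?t *s z) - B (?t *s z))"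
        using Bc t by (simp add: complex_linear_def vec_eq_iff field_simps)
      then have "norm (?A - B z) = norm (\<Omega> (?t *s z) - B (?t *s z)) / \<tau> s"
        unfolding \<open>?A - B z = _\<close> norm_smult_vec using t by (simp add: norm_divide)
      also have "\<dots> \<le> \<kappa> / (2 * C)" using le t by (simp add: divide_le_eq)
      finally have "norm (1 - ?\<zeta> s) * norm (?A - B z) \<le> C * (\<kappa> / (2 * C))"
        using C s by (intro mult_mono) auto
      then have small: "norm ((1 - ?\<zeta> s) *s (?A - B z)) \<le> \<kappa> / 2"
        unfolding norm_smult_vec using C(1) by simp
      have "(1 - ?\<zeta> s) *s B z + ?\<zeta> s *s OmegaJ z = \<Omega>s s z - (1 - ?\<zeta> s) *s (?A - B z)"
        unfolding eq by (simp add: vec_eq_iff algebra_simps)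
      then have "(1 - ?\<zeta> s) *s B z + ?\<zeta> s *s OmegaJ z = - ((1 - ?\<zeta> s) *s (?A - B z))"
        unfolding zero by simp
      then have "norm ((1 - ?\<zeta> s) *s B z + ?\<zeta> s *s OmegaJ z) \<le> \<kappa> / 2"
        using small by (metis norm_minus_cancel)
      then show False using \<kappa>(1) \<kappa>(2)[OF s z] by simp
    qed
  qed
  \<comment> \<open>At s = 1 the factor 1 - \<zeta> vanishes, so J is reached exactly although
    \<tau> ends at \<delta> and not at 0.\<close>
  have "\<Omega>s 0 z = \<Omega> z" "\<Omega>s 1 z = OmegaJ z" for z
    using \<tau>01(1)[of 0] by (simp_all add: \<Omega>s_eq)
  then show ?thesis
    using V smooth hol_s rad nz by (intro exI[of _ V] exI[of _ \<Omega>s]) auto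
qed

end
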